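(* Let $G=(V,E)$ be a finite simple graph that is semi-bipartite and $1$-regular (in the semi-bipartite sense): $V$ is a disjoint union $V=V_g\cup V_b$, where $V_g$ is a clique, $V_b$ is an isolated set, and every vertex of $V_b$ has degree $1$ in $G$. Let $m=\#(V)$ and let $\lambda_1\ge\lambda_2\ge\dots\ge\lambda_m$ be the eigenvalues, with multiplicity, of the graph Laplacian $L_G$. Then for every $1\le j\le m$, $$\sum_{l=1}^{j}\lambda_l\le\sum_{l=1}^{j}d_l^T,$$ where $d_l^T$ denotes the number of vertices of $G$ of degree at least $l$.
   Context: For a graph $G=(V,E)$, the graph Laplacian $L_G$ is the matrix with rows and columns indexed by $V$ whose diagonal entry at $v$ is the degree of $v$ and whose entry at a pair $(v,w)$ with $v\ne w$ is $-1$ if $(v,w)\in E$ and $0$ otherwise. A clique is a set of vertices any two distinct members of which are adjacent; an isolated set is a set of vertices no two of which are adjacent (an independent set). The transpose degree sequence of $G$ is $(d_l^T)_{l\ge1}$, where $d_l^T$ is the number of vertices of degree at least $l$. The displayed inequalities are the Grone-Merris conjecture for $G$. *)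

theory Defs
  imports
    "Graph_Theory.Pair_Digraph"
    "Jordan_Normal_Form.Char_Poly"
begin

text \<open>
  Finite simple graphs are the locale \<^locale>\<open>pair_graph\<close>: the vertex set \<open>pverts G\<close> is finite,
  and \<open>parcs G\<close> is an irreflexive symmetric relation on it, each edge being present
  in both directions. Hence the degree of a vertex is its out-degree.
\<close>

definition vertex_degree :: "'a pair_pre_digraph \<Rightarrow> 'a \<Rightarrow> nat" where
  "vertex_degree G v = out_degree (with_proj G) v"

definition clique :: "'a pair_pre_digraph \<Rightarrow> 'a set \<Rightarrow> bool" where
  "clique G S \<longleftrightarrow> S \<subseteq> pverts G \<and> (\<forall>v\<in>S. \<forall>w\<in>S. v \<noteq> w \<longrightarrow> (v, w) \<in> parcs G)"

definition isolated_set :: "'a pair_pre_digraph \<Rightarrow> 'a set \<Rightarrow> bool" where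
  "isolated_set G S \<longleftrightarrow> S \<subseteq> pverts G \<and> (\<forall>v\<in>S. \<forall>w\<in>S. (v, w) \<notin> parcs G)"

definition semi_bipartite :: "'a pair_pre_digraph \<Rightarrow> 'a set \<Rightarrow> 'a set \<Rightarrow> bool" where
  "semi_bipartite G Vg Vb \<longleftrightarrow>
     pverts G = Vg \<union> Vb \<and> Vg \<inter> Vb = {} \<and> clique G Vg \<and> isolated_set G Vb"

definition semi_bipartite_regular ::
    "nat \<Rightarrow> 'a pair_pre_digraph \<Rightarrow> 'a set \<Rightarrow> 'a set \<Rightarrow> bool" where
  "semi_bipartite_regular k G Vg Vb \<longleftrightarrow>
     semi_bipartite G Vg Vb \<and> (\<forall>v\<in>Vb. vertex_degree G v = k)"

definition transpose_degree :: "'a pair_pre_digraph \<Rightarrow> nat \<Rightarrow> nat" where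
  "transpose_degree G l = card {v \<in> pverts G. l \<le> vertex_degree G v}"

definition laplacian_entry :: "'a pair_pre_digraph \<Rightarrow> 'a \<Rightarrow> 'a \<Rightarrow> real" where
  "laplacian_entry G v w =
     (if v = w then real (vertex_degree G v) else if (v, w) \<in> parcs G then - 1 else 0)"

text \<open>
  Matrices are indexed by natural numbers, so the vertices are listed without repetition in \<open>vs\<close>.
\<close>

definition laplacian :: "'a pair_pre_digraph \<Rightarrow> 'a list \<Rightarrow> real mat" where
  "laplacian G vs =
     mat (length vs) (length vs) (\<lambda>(i, j). laplacian_entry G (vs ! i) (vs ! j))"

text \<open>
  The real eigenvalues, counted with algebraic multiplicity, in decreasing order. The list is
  0-based: \<open>\<lambda>\<^sub>l\<close> is entry \<open>l - 1\<close>. For a symmetric matrix it is complete, see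
  \<open>length_eigenvalues_desc\<close>.
\<close>

definition eigenvalues_desc :: "real mat \<Rightarrow> real list" where
  "eigenvalues_desc A = rev (sorted_list_of_multiset (proots (char_poly A)))"

lemma symmetric_real_eigenvalue:
  fixes A :: "real mat"
  assumes A: "A \<in> carrier_mat n n" and sym: "transpose_mat A = A"
    and ev: "eigenvalue (map_mat complex_of_real A) a"
  shows "a \<in> \<real>"
proof -
  define C where "C = map_mat complex_of_real A"
  have C: "C \<in> carrier_mat n n" using A by (simp add: C_def)
  from ev obtain v where v: "v \<in> carrier_vec n" "v \<noteq> 0\<^sub>v n" "C *\<^sub>v v = a \<cdot>\<^sub>v v"
    using C unfolding eigenvalue_def eigenvector_def C_def by auto
  have conjC: "conjugate (C *\<^sub>v v) = C *\<^sub>v conjugate v"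
    using A v(1) by (intro eq_vecI) (auto simp: C_def scalar_prod_def cnj_sum)
  have transC: "transpose_mat C = C"
    using sym by (metis C_def map_mat_transpose)
  have "a * (v \<bullet>c v) = (C *\<^sub>v v) \<bullet>c v" using v by simp
  also have "\<dots> = v \<bullet> (C *\<^sub>v conjugate v)"
    using transpose_vec_mult_scalar[OF C _ v(1), of "conjugate v"] v(1) transC by simp
  also have "\<dots> = v \<bullet>c (a \<cdot>\<^sub>v v)" using conjC v(3) by simp
  also have "\<dots> = cnj a * (v \<bullet>c v)"
    using v(1) by (simp add: conjugate_smult_vec)
  finally have "a = cnj a" using v by simp
  thus ?thesis by (simp add: Reals_cnj_iff)
qed

lemma length_eigenvalues_desc:
  assumes A: "A \<in> carrier_mat n n" and sym: "transpose_mat A = A"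
  shows "length (eigenvalues_desc A) = n"
proof -
  interpret real_poly: map_poly_inj_comm_ring_hom complex_of_real ..
  define C where "C = map_mat complex_of_real A"
  have C: "C \<in> carrier_mat n n" using A by (simp add: C_def)
  from char_poly_factorized[OF C] obtain as
    where as: "char_poly C = (\<Prod>a\<leftarrow>as. [:- a, 1:])" "length as = n" by blast
  have "a \<in> \<real>" if "a \<in> set as" for a
  proof (rule symmetric_real_eigenvalue[OF A sym])
    have "poly (char_poly C) a = 0"
      using that unfolding as(1) by (auto simp: poly_prod_list prod_list_zero_iff)
    thus "eigenvalue (map_mat complex_of_real A) a"
      using eigenvalue_root_char_poly[OF C] by (simp add: C_def)
  qed
  hence "\<exists>rs. as = map complex_of_real rs"
    by (auto simp: ex_map_conv elim: Reals_cases)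
  then obtain rs where rs: "as = map complex_of_real rs" by blast
  have prod_hom: "map_poly complex_of_real (\<Prod>a\<leftarrow>xs. [:- a, 1:])
      = (\<Prod>a\<leftarrow>map complex_of_real xs. [:- a, 1:])" for xs
    by (induction xs)
      (simp_all add: real_poly.hom_mult of_real_hom.map_poly_pCons_hom del: mult_pCons_left)
  have "map_poly complex_of_real (char_poly A) = char_poly C"
    unfolding C_def by (rule of_real_hom.char_poly_hom[OF A, symmetric])
  also have "\<dots> = map_poly complex_of_real (\<Prod>a\<leftarrow>rs. [:- a, 1:])"
    unfolding as(1) rs prod_hom ..
  finally have "char_poly A = (\<Prod>a\<leftarrow>rs. [:- a, 1:])" by simp
  moreover have "proots (\<Prod>a\<leftarrow>rs. [:- a, 1:]) = mset rs" for rs :: "real list"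
  proof (induction rs)
    case (Cons r rs)
    have "(\<Prod>a\<leftarrow>rs. [:- a, 1:]) \<noteq> 0" by (auto simp: prod_list_zero_iff)
    thus ?case using Cons by (simp add: proots_mult del: mult_pCons_left)
  qed simp
  ultimately show ?thesis
    using as(2) rs by (simp add: eigenvalues_desc_def)
qed

end

theory Submission
  imports Defs "Jordan_Normal_Form.Schur_Decomposition"
begin

text \<open>
  Let the clique have \<open>n\<close> vertices, the \<open>i\<close>-th one with \<open>a\<^sub>i\<close> pendant vertices, let \<open>b\<close> be the sum
  of the \<open>a\<^sub>i\<close>, and let \<open>p\<close> of them be positive. The right-hand side is the sum over all vertices
  of \<open>min (degree) j\<close>. For \<open>j \<ge> n\<close> it is either the trace, or it suffices that at most \<open>p\<close>
  eigenvalues are below \<open>1\<close>, which is a dimension count. For \<open>j < n\<close> it is \<open>j n + b\<close>, and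
  one needs that the excesses \<open>\<lambda> - n\<close> of the eigenvalues \<open>\<lambda> > n\<close> add up to at most \<open>b\<close>.

  A Riccati equation \<open>(n - 1 + A) h = h A h + J - I\<close> with \<open>A = diag a\<close> and \<open>J\<close> the all-ones matrix
  describes a complement of these eigenspaces that is invariant under the Laplacian plus the matrix
  with ones in the rows of the clique. Its minimal solution is entrywise nonnegative with column
  sums at most \<open>1\<close>. The excesses are eigenvalues of \<open>(I - h) A\<close>, whose
  trace is at most \<open>b\<close> and whose other eigenvalues, by diagonal dominance of the columns, have
  nonnegative real part.
\<close>

section \<open>Orthogonal diagonalization\<close>

text \<open>The Householder reflection along \<open>u = v - e_0\<close>, which swaps
  \<open>v\<close> with the first basis vector \<open>e_0\<close>; if the two coincide, the identity
  serves. Being symmetric and its own inverse, it is an orthogonal change of basis that brings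
  \<open>v\<close> to the front.\<close>

lemma reflection_onto_unit_vector:
  fixes v :: "real vec"
  assumes v: "v \<in> carrier_vec n" and n: "0 < n" and unit: "v \<bullet> v = 1"
  shows "\<exists>H \<in> carrier_mat n n. transpose_mat H = H \<and> H * H = 1\<^sub>m n \<and> col H 0 = v"
proof (cases "v = unit_vec n 0")
  case True
  then show ?thesis using n by (intro bexI[of _ "1\<^sub>m n"]) auto
next
  case False
  have sq: "(\<Sum>l<n. v $ l * v $ l) = 1"
    using unit v by (simp add: scalar_prod_def lessThan_atLeast0)
  define u where "u i = v $ i - (if i = 0 then 1 else 0)" for i
  have uu: "(\<Sum>l<n. u l * u l) = 2 * (1 - v $ 0)"
  proof -
    have "(\<Sum>l<n. u l * u l) =
        (\<Sum>l<n. v $ l * v $ l + (if l = 0 then 1 - 2 * v $ 0 else 0))"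
      by (intro sum.cong) (auto simp: u_def algebra_simps)
    also have "\<dots> = 2 * (1 - v $ 0)" using n by (simp add: sum.distrib sq)
    finally show ?thesis .
  qed
  have v0: "v $ 0 \<noteq> 1"
  proof
    assume "v $ 0 = 1"
    hence "(\<Sum>l<n. u l * u l) = 0" using uu by simp
    hence "\<forall>l<n. u l = 0" by (subst (asm) sum_nonneg_eq_0_iff) auto
    hence "v = unit_vec n 0" using v by (intro eq_vecI) (auto simp: u_def)
    with False show False by simp
  qed
  \<comment> \<open>This is 2 divided by the squared length of \<open>u\<close>, so \<open>H\<close>
    below is the reflection in the hyperplane orthogonal to \<open>u\<close>.\<close>
  define k where "k = 1 / (1 - v $ 0)"
  have kuu: "k * (\<Sum>l<n. u l * u l) = 2" using v0 by (simp add: uu k_def field_simps)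
  define H where "H = mat n n (\<lambda>(i, j). (if i = j then 1 else 0) - k * u i * u j)"
  have H: "H \<in> carrier_mat n n" by (simp add: H_def)
  have "H * H = 1\<^sub>m n"
  proof (rule eq_matI)
    fix i j assume "i < dim_row (1\<^sub>m n :: real mat)" "j < dim_col (1\<^sub>m n :: real mat)"
    hence ij: "i < n" "j < n" by auto
    have "(H * H) $$ (i, j) = (\<Sum>l<n. ((if i = l then 1 else 0) - k * u i * u l)
        * ((if l = j then 1 else 0) - k * u l * u j))"
      using ij H by (simp add: scalar_prod_def H_def lessThan_atLeast0)
    also have "\<dots> = (\<Sum>l<n. (if l = i then (if i = j then 1 else 0) - k * u i * u j else 0)
        + (if l = j then - k * u i * u j else 0) + k * u i * u j * (k * (u l * u l)))"
      by (intro sum.cong) (auto simp: algebra_simps)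
    also have "\<dots> = (if i = j then 1 else 0) - 2 * k * u i * u j
        + k * u i * u j * (k * (\<Sum>l<n. u l * u l))"
      using ij by (simp add: sum.distrib sum_distrib_left)
    also have "\<dots> = (if i = j then 1 else 0)" by (simp add: kuu)
    finally show "(H * H) $$ (i, j) = 1\<^sub>m n $$ (i, j)" using ij by simp
  qed (use H in auto)
  moreover have "transpose_mat H = H" by (rule eq_matI) (auto simp: H_def)
  moreover have "col H 0 = v"
  proof (rule eq_vecI)
    fix i assume i: "i < dim_vec v"
    have "k * u 0 = - 1" using v0 by (simp add: k_def u_def field_simps)
    hence "k * u i * u 0 = - u i" by (metis mult.assoc mult.commute mult_minus1)
    thus "col H 0 $ i = v $ i" using i v n by (simp add: H_def u_def)
  qed (use v H in auto)
  ultimately show ?thesis using H by blast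
qed

text \<open>Deflation: the reflection that moves a unit eigenvector for \<open>e\<close> to the
  front splits \<open>A\<close> into the block \<open>e\<close> and a smaller matrix, symmetry
  clearing the first row along with the first column. Cancelling the factor of \<open>e\<close>
  leaves the remaining roots for the induction. The list \<open>es\<close> fixes the order of the
  diagonal entries.\<close>

theorem real_symmetric_diagonalization:
  fixes A :: "real mat"
  assumes "A \<in> carrier_mat n n" "transpose_mat A = A"
    and "char_poly A = (\<Prod>a\<leftarrow>es. [:- a, 1:])"
  shows "\<exists>P \<in> carrier_mat n n. transpose_mat P * P = 1\<^sub>m n \<and>
    transpose_mat P * A * P = mat n n (\<lambda>(i, j). if i = j then es ! i else 0)"
  using assms
proof (induction es arbitrary: n A)
  case Nil
  then have "n = 0" using degree_monic_char_poly[of A n] by auto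
  then show ?case using Nil by (intro bexI[of _ "1\<^sub>m 0"] conjI eq_matI) auto
next
  case (Cons e es n' A)
  note A = Cons.prems(1) and sym = Cons.prems(2)
  have "eigenvalue A e"
    unfolding eigenvalue_root_char_poly[OF A] Cons.prems(3) by simp
  then obtain w where w: "w \<in> carrier_vec n'" "w \<noteq> 0\<^sub>v n'" "A *\<^sub>v w = e \<cdot>\<^sub>v w"
    using A unfolding eigenvalue_def eigenvector_def by auto
  define v where "v = (1 / sqrt (w \<bullet> w)) \<cdot>\<^sub>v w"
  have ww: "w \<bullet> w > 0"
  proof -
    have "conjugate w = w" by (intro eq_vecI) auto
    thus ?thesis using w(2) conjugate_square_greater_0_vec[OF w(1)] by simp
  qed
  have v: "v \<in> carrier_vec n'" "A *\<^sub>v v = e \<cdot>\<^sub>v v"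
    using w A by (auto simp: v_def mult_mat_vec smult_smult_assoc mult.commute)
  have vv: "v \<bullet> v = 1" using w(1) ww by (simp add: v_def)
  have "n' \<noteq> 0" using w by (intro notI) auto
  then obtain n where n': "n' = Suc n" by (cases n') auto
  obtain H where H: "H \<in> carrier_mat n' n'" "transpose_mat H = H" "H * H = 1\<^sub>m n'" "col H 0 = v"
    using reflection_onto_unit_vector[OF v(1) _ vv] \<open>n' \<noteq> 0\<close> by auto
  define B where "B = H * A * H"
  have B: "B \<in> carrier_mat n' n'" using H A by (simp add: B_def)
  have symB: "transpose_mat B = B"
    using H(1,2) A sym unfolding B_def
    by (simp add: transpose_mult[of _ n' n' _ n'])
  have colB: "col B 0 = e \<cdot>\<^sub>v unit_vec n' 0"
  proof -
    have "col B 0 = (H * A) *\<^sub>v v"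
      unfolding B_def H(4)[symmetric] using H A n' by (intro col_mult2) auto
    also have "\<dots> = H *\<^sub>v (A *\<^sub>v v)" using H A v by simp
    also have "\<dots> = e \<cdot>\<^sub>v (H *\<^sub>v v)" using v H by (simp add: mult_mat_vec)
    also have "H *\<^sub>v v = col (H * H) 0"
      unfolding H(4)[symmetric] using H(1) n' by (intro col_mult2[symmetric]) auto
    finally show ?thesis using H n' by simp
  qed
  have B0: "B $$ (i, 0) = (if i = 0 then e else 0)" if "i < n'" for i
    using arg_cong[OF colB, of "\<lambda>v. v $ i"] that B n' by auto
  have B0': "B $$ (0, i) = (if i = 0 then e else 0)" if "i < n'" for i
    using B0[OF that] symB B that n' by (metis carrier_matD index_transpose_mat(1) zero_less_Suc)
  define A3 where "A3 = mat n n (\<lambda>(i, j). B $$ (Suc i, Suc j))"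
  have A3: "A3 \<in> carrier_mat n n" by (simp add: A3_def)
  define E where "E = mat 1 1 (\<lambda>_. e)"
  have E: "E \<in> carrier_mat 1 1" by (simp add: E_def)
  have Bblock: "B = four_block_mat E (0\<^sub>m 1 n) (0\<^sub>m n 1) A3"
  proof (rule eq_matI)
    fix i j assume "i < dim_row (four_block_mat E (0\<^sub>m 1 n) (0\<^sub>m n 1) A3)"
      "j < dim_col (four_block_mat E (0\<^sub>m 1 n) (0\<^sub>m n 1) A3)"
    then show "B $$ (i, j) = four_block_mat E (0\<^sub>m 1 n) (0\<^sub>m n 1) A3 $$ (i, j)"
      using n' B0[of i] B0'[of j] by (cases i; cases j) (auto simp: A3_def E_def)
  qed (use B n' in \<open>auto simp: A3_def E_def\<close>)
  have symA3: "transpose_mat A3 = A3"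
  proof (rule eq_matI)
    fix i j assume "i < dim_row A3" "j < dim_col A3"
    then show "transpose_mat A3 $$ (i, j) = A3 $$ (i, j)"
      using symB B n' unfolding A3_def
      by simp (metis Suc_less_eq carrier_matD index_transpose_mat(1))
  qed (auto simp: A3_def)
  have "char_poly B = char_poly A"
  proof (rule char_poly_similar, unfold similar_mat_def similar_mat_wit_def, intro exI)
    show "let n = dim_row B in {B, A, H, H} \<subseteq> carrier_mat n n \<and> H * H = 1\<^sub>m n \<and> H * H = 1\<^sub>m n
        \<and> B = H * A * H"
      using B A H by (auto simp: Let_def B_def)
  qed
  moreover have "char_poly B = char_poly E * char_poly A3"
    unfolding Bblock using E A3 by (intro char_poly_four_block_zeros_col) auto
  moreover have "char_poly E = [:- e, 1:]"
    by (simp add: char_poly_def char_poly_matrix_def E_def det_single)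
  ultimately have "[:- e, 1:] * char_poly A3 = [:- e, 1:] * (\<Prod>a\<leftarrow>es. [:- a, 1:])"
    using Cons.prems(3) by simp
  hence "char_poly A3 = (\<Prod>a\<leftarrow>es. [:- a, 1:])"
    by (subst (asm) mult_left_cancel) auto
  from Cons.IH[OF A3 symA3 this] obtain P3 where P3: "P3 \<in> carrier_mat n n"
    "transpose_mat P3 * P3 = 1\<^sub>m n"
    "transpose_mat P3 * A3 * P3 = mat n n (\<lambda>(i, j). if i = j then es ! i else 0)" by auto
  define F where "F = four_block_mat (1\<^sub>m 1) (0\<^sub>m 1 n) (0\<^sub>m n 1) P3"
  have F: "F \<in> carrier_mat n' n'" using P3 n' by (auto simp: F_def)
  have FT: "transpose_mat F = four_block_mat (1\<^sub>m 1) (0\<^sub>m 1 n) (0\<^sub>m n 1) (transpose_mat P3)"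
    unfolding F_def using P3 by (subst transpose_four_block_mat[of _ 1 1 _ n _ n]) auto
  have one: "four_block_mat (1\<^sub>m 1) (0\<^sub>m 1 n) (0\<^sub>m n 1) (1\<^sub>m n) = 1\<^sub>m n'"
    using n' by (intro eq_matI) (auto split: nat.splits)
  have FF: "transpose_mat F * F = 1\<^sub>m n'"
    unfolding FT unfolding F_def using P3
    by (subst mult_four_block_mat[of _ 1 1 _ n _ n _ _ 1 _ n]) (auto simp: one n')
  have "transpose_mat F * B * F
      = four_block_mat E (0\<^sub>m 1 n) (0\<^sub>m n 1) (transpose_mat P3 * A3 * P3)"
    unfolding FT Bblock unfolding F_def using P3 A3 E
    apply (subst mult_four_block_mat[of _ 1 1 _ n _ n _ _ 1 _ n]; simp?)
    apply (subst mult_four_block_mat[of _ 1 1 _ n _ n _ _ 1 _ n]; simp?)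
    done
  also have "\<dots> = mat n' n' (\<lambda>(i, j). if i = j then (e # es) ! i else 0)"
    unfolding P3(3) using n'
    by (intro eq_matI) (auto simp: E_def nth_Cons split: nat.splits)
  finally have FBF: "transpose_mat F * B * F = \<dots>" .
  define P where "P = H * F"
  have P: "P \<in> carrier_mat n' n'" using H F by (simp add: P_def)
  have PT: "transpose_mat P = transpose_mat F * H"
    using H F by (simp add: P_def transpose_mult[of _ n' n' _ n'])
  have "transpose_mat P * P = transpose_mat F * (H * H) * F"
    unfolding PT unfolding P_def using H(1) F
    by (simp add: assoc_mult_mat[of _ n' n' _ n' _ n'])
  also have "\<dots> = 1\<^sub>m n'" using F FF H(3) by simp
  finally have 1: "transpose_mat P * P = 1\<^sub>m n'" .
  have "transpose_mat P * A * P = transpose_mat F * B * F"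
    unfolding PT unfolding P_def B_def using H(1) F A
    by (simp add: assoc_mult_mat[of _ n' n' _ n' _ n'])
  with 1 FBF P show ?case by auto
qed

section \<open>Left-invariant subspaces of column-dominant matrices\<close>

lemma trace_mult_commute:
  fixes A B :: "'a :: comm_semiring_0 mat"
  assumes "A \<in> carrier_mat n k" "B \<in> carrier_mat k n"
  shows "(\<Sum>i<n. (A * B) $$ (i, i)) = (\<Sum>j<k. (B * A) $$ (j, j))"
proof -
  have "(\<Sum>i<n. (A * B) $$ (i, i)) = (\<Sum>i<n. \<Sum>j<k. A $$ (i, j) * B $$ (j, i))"
    using assms by (simp add: scalar_prod_def lessThan_atLeast0)
  also have "\<dots> = (\<Sum>j<k. \<Sum>i<n. B $$ (j, i) * A $$ (i, j))"
    by (subst sum.swap) (simp add: mult.commute)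
  also have "\<dots> = (\<Sum>j<k. (B * A) $$ (j, j))"
    using assms by (simp add: scalar_prod_def lessThan_atLeast0)
  finally show ?thesis .
qed

text \<open>Schur triangularization puts the eigenvalues on the diagonal, and similarity preserves
  the trace.\<close>

lemma Re_trace_nonneg:
  fixes M :: "complex mat"
  assumes M: "M \<in> carrier_mat n n" and ev: "\<And>\<mu>. eigenvalue M \<mu> \<Longrightarrow> 0 \<le> Re \<mu>"
  shows "0 \<le> Re (\<Sum>i<n. M $$ (i, i))"
proof -
  from char_poly_factorized[OF M] obtain as
    where as: "char_poly M = (\<Prod>a\<leftarrow>as. [:- a, 1:])" "length as = n" by blast
  obtain B P Q where "schur_decomposition M as = (B, P, Q)" by (metis prod_cases3)
  from schur_decomposition[OF M as(1) this]
  have wit: "similar_mat_wit M B P Q" and diag: "diag_mat B = as" by auto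
  note w = similar_mat_witD2[OF M wit]
  have B: "B \<in> carrier_mat n n" "P \<in> carrier_mat n n" "Q \<in> carrier_mat n n" using w by auto
  have "(\<Sum>i<n. M $$ (i, i)) = (\<Sum>i<n. (P * (B * Q)) $$ (i, i))"
    using w B by simp
  also have "\<dots> = (\<Sum>i<n. ((B * Q) * P) $$ (i, i))"
    by (rule trace_mult_commute) (use B in auto)
  also have "(B * Q) * P = B"
    using w B by simp
  finally have tr: "(\<Sum>i<n. M $$ (i, i)) = (\<Sum>i<n. B $$ (i, i))" .
  have "0 \<le> Re (B $$ (i, i))" if "i < n" for i
  proof -
    have "B $$ (i, i) \<in> set as" using diag B that by (auto simp: diag_mat_def)
    hence "poly (char_poly M) (B $$ (i, i)) = 0"
      unfolding as(1) by (auto simp: poly_prod_list prod_list_zero_iff)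
    thus ?thesis using ev eigenvalue_root_char_poly[OF M] by blast
  qed
  thus ?thesis unfolding tr Re_sum by (intro sum_nonneg) auto
qed

text \<open>Gershgorin's theorem for columns, as an estimate in the 1-norm: the rows of the
  eigenvector equation are bounded entrywise and added up, and exchanging the sums produces the
  off-diagonal column sums.\<close>

lemma column_dominant_eigenvalue:
  fixes N :: "real mat"
  assumes N: "N \<in> carrier_mat n n"
    and dom: "\<And>j. j < n \<Longrightarrow> (\<Sum>i\<in>{..<n} - {j}. \<bar>N $$ (i, j)\<bar>) \<le> N $$ (j, j)"
    and ev: "eigenvalue (map_mat complex_of_real N) \<mu>"
  shows "0 \<le> Re \<mu>"
proof (rule ccontr)
  assume neg: "\<not> 0 \<le> Re \<mu>"
  from ev obtain v where v: "v \<in> carrier_vec n" "v \<noteq> 0\<^sub>v n"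
    "map_mat complex_of_real N *\<^sub>v v = \<mu> \<cdot>\<^sub>v v"
    using N unfolding eigenvalue_def eigenvector_def by auto
  have diag_nn: "0 \<le> N $$ (j, j)" if "j < n" for j
    by (rule order_trans[OF _ dom[OF that]]) (simp add: sum_nonneg)
  have shift: "N $$ (j, j) < cmod (N $$ (j, j) - \<mu>)" if "j < n" for j
    using abs_Re_le_cmod[of "N $$ (j, j) - \<mu>"] neg by simp
  have row: "cmod (N $$ (i, i) - \<mu>) * cmod (v $ i)
      \<le> (\<Sum>j\<in>{..<n} - {i}. \<bar>N $$ (i, j)\<bar> * cmod (v $ j))" if i: "i < n" for i
  proof -
    have "\<mu> * v $ i = (\<Sum>j<n. N $$ (i, j) * v $ j)"
      using arg_cong[OF v(3), of "\<lambda>w. w $ i"] i v(1) N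
      by (simp add: scalar_prod_def lessThan_atLeast0)
    also have "\<dots> = N $$ (i, i) * v $ i + (\<Sum>j\<in>{..<n} - {i}. N $$ (i, j) * v $ j)"
      using i by (subst sum.remove[of _ i]) auto
    finally have "(N $$ (i, i) - \<mu>) * v $ i = - (\<Sum>j\<in>{..<n} - {i}. N $$ (i, j) * v $ j)"
      by (simp add: algebra_simps)
    hence "cmod (N $$ (i, i) - \<mu>) * cmod (v $ i)
        = cmod (\<Sum>j\<in>{..<n} - {i}. N $$ (i, j) * v $ j)"
      by (metis norm_minus_cancel norm_mult)
    also have "\<dots> \<le> (\<Sum>j\<in>{..<n} - {i}. \<bar>N $$ (i, j)\<bar> * cmod (v $ j))"
      by (rule sum_norm_le) (simp add: norm_mult)
    finally show ?thesis .
  qed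
  obtain i0 where i0: "i0 < n" "v $ i0 \<noteq> 0"
    using v(1,2) by (metis carrier_vecD dim_vec eq_vecI index_zero_vec(1) zero_carrier_vec)
  \<comment> \<open>A negative real part makes every distance
    \<open>cmod (N $$ (i, i) - \<mu>)\<close> exceed \<open>N $$ (i, i)\<close>, and the nonzero
    coordinate \<open>i0\<close> makes the sum strictly larger. The chain then returns to its
    starting value.\<close>
  have "(\<Sum>i<n. N $$ (i, i) * cmod (v $ i)) < (\<Sum>i<n. cmod (N $$ (i, i) - \<mu>) * cmod (v $ i))"
    using i0 shift by (intro sum_strict_mono_ex1 ballI bexI[of _ i0] mult_right_mono) (auto intro: less_imp_le)
  also have "\<dots> \<le> (\<Sum>i<n. \<Sum>j\<in>{..<n} - {i}. \<bar>N $$ (i, j)\<bar> * cmod (v $ j))"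
    using row by (intro sum_mono) auto
  also have "\<dots> = (\<Sum>i<n. \<Sum>j | j < n \<and> j \<noteq> i. \<bar>N $$ (i, j)\<bar> * cmod (v $ j))"
    by (intro sum.cong) auto
  also have "\<dots> = (\<Sum>j<n. \<Sum>i | i < n \<and> j \<noteq> i. \<bar>N $$ (i, j)\<bar> * cmod (v $ j))"
    using sum.swap_restrict[of "{..<n}" "{..<n}" "\<lambda>i j. \<bar>N $$ (i, j)\<bar> * cmod (v $ j)" "\<lambda>i j. j \<noteq> i"]
    by simp
  also have "\<dots> = (\<Sum>j<n. \<Sum>i\<in>{..<n} - {j}. \<bar>N $$ (i, j)\<bar> * cmod (v $ j))"
    by (intro sum.cong) auto
  also have "\<dots> \<le> (\<Sum>j<n. N $$ (j, j) * cmod (v $ j))"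
    unfolding sum_distrib_right[symmetric] using dom by (intro sum_mono mult_right_mono) auto
  finally show False by simp
qed

text \<open>
  With \<open>Q = X\<^sup>T (X X\<^sup>T)\<inverse> X\<close>, the nonzero eigenvalues of \<open>N (1 - Q)\<close> are eigenvalues of \<open>N\<close>, so
  they have nonnegative real part, and \<open>N Q\<close> has the trace of \<open>T\<close>.
\<close>

lemma trace_left_invariant_le:
  fixes N X T :: "real mat"
  assumes N: "N \<in> carrier_mat n n" and X: "X \<in> carrier_mat k n" and T: "T \<in> carrier_mat k k"
    and dom: "\<And>j. j < n \<Longrightarrow> (\<Sum>i\<in>{..<n} - {j}. \<bar>N $$ (i, j)\<bar>) \<le> N $$ (j, j)"
    and XN: "X * N = T * X"
    and indep: "\<And>v. v \<in> carrier_vec k \<Longrightarrow> transpose_mat X *\<^sub>v v = 0\<^sub>v n \<Longrightarrow> v = 0\<^sub>v k"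
  shows "(\<Sum>l<k. T $$ (l, l)) \<le> (\<Sum>i<n. N $$ (i, i))"
proof -
  \<comment> \<open>The Gram matrix of the rows of \<open>X\<close>. A kernel vector
    \<open>v\<close> of \<open>G\<close> gives \<open>X\<^sup>T v\<close> length zero, so
    independence of the rows makes \<open>G\<close> invertible.\<close>
  define G where "G = X * transpose_mat X"
  have G: "G \<in> carrier_mat k k" using X by (simp add: G_def)
  have XT: "transpose_mat X \<in> carrier_mat n k" using X by simp
  have "det G \<noteq> 0"
  proof
    assume "det G = 0"
    then obtain v where v: "v \<in> carrier_vec k" "v \<noteq> 0\<^sub>v k" "G *\<^sub>v v = 0\<^sub>v k"
      using det_0_iff_vec_prod_zero[OF G] by auto
    define u where "u = transpose_mat X *\<^sub>v v"
    have u: "u \<in> carrier_vec n" using XT v by (simp add: u_def)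
    have "u \<bullet> u = v \<bullet> (X *\<^sub>v u)"
      using transpose_vec_mult_scalar[OF X u v(1)] by (simp add: u_def)
    also have "X *\<^sub>v u = 0\<^sub>v k" using v X XT by (simp add: u_def G_def)
    finally have "u \<bullet> u = 0" using v by simp
    moreover have "conjugate u = u" by (intro eq_vecI) auto
    ultimately have "u = 0\<^sub>v n" using conjugate_square_eq_0_vec[OF u] by simp
    with indep v show False by (auto simp: u_def)
  qed
  then obtain G' where G': "G' \<in> carrier_mat k k" "G * G' = 1\<^sub>m k"
    using det_non_zero_imp_unit[OF G, of "()"] unfolding Units_def ring_mat_def by auto
  \<comment> \<open>A right inverse of \<open>X\<close>, so that \<open>Y * X\<close> is the
    projection \<open>Q\<close> and \<open>M\<close> below is \<open>N (1 - Q)\<close>.\<close>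
  define Y where "Y = transpose_mat X * G'"
  have Y: "Y \<in> carrier_mat n k" using XT G' by (simp add: Y_def)
  have XY: "X * Y = 1\<^sub>m k" using X XT G' by (simp add: Y_def G_def)
  define M where "M = N - N * Y * X"
  have M: "M \<in> carrier_mat n n"
    unfolding M_def using N X Y by (intro minus_carrier_mat mult_carrier_mat)
  have XM: "X * M = 0\<^sub>m k n"
  proof -
    have "X * (N * Y * X) = (X * N) * (Y * X)" using X N Y
      by (simp add: assoc_mult_mat[of X k n N n "Y * X" n] assoc_mult_mat[of N n n Y k X n])
    also have "\<dots> = T * ((X * Y) * X)" unfolding XN using X Y T
      by (simp add: assoc_mult_mat[of T k k X n "Y * X" n] assoc_mult_mat[of X k n Y k X n])
    also have "\<dots> = X * N" unfolding XN XY using X by simp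
    finally have "X * (N * Y * X) = X * N" .
    moreover have "X * M = X * N - X * (N * Y * X)"
      unfolding M_def using X N Y by (intro mult_minus_distrib_mat) auto
    ultimately show ?thesis using X N by simp
  qed
  \<comment> \<open>Since \<open>X * M\<close> vanishes, \<open>X\<close> kills every eigenvector of
    \<open>M\<close> with nonzero eigenvalue. On such a vector \<open>Q\<close> vanishes and
    \<open>M\<close> acts as \<open>N\<close>.\<close>
  have "0 \<le> Re \<mu>" if "eigenvalue (map_mat complex_of_real M) \<mu>" for \<mu>
  proof (cases "\<mu> = 0")
    case False
    let ?c = "map_mat complex_of_real"
    have carr: "?c N \<in> carrier_mat n n" "?c X \<in> carrier_mat k n" "?c Y \<in> carrier_mat n k"
      "?c M \<in> carrier_mat n n" using N X Y M by auto
    from that obtain v where v: "v \<in> carrier_vec n" "v \<noteq> 0\<^sub>v n" "?c M *\<^sub>v v = \<mu> \<cdot>\<^sub>v v"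
      using M unfolding eigenvalue_def eigenvector_def by auto
    have Xv: "?c X *\<^sub>v v \<in> carrier_vec k" using carr v by auto
    have "\<mu> \<cdot>\<^sub>v (?c X *\<^sub>v v) = ?c X *\<^sub>v (?c M *\<^sub>v v)"
      using v carr by (simp add: mult_mat_vec)
    also have "\<dots> = (?c X * ?c M) *\<^sub>v v" using v carr by simp
    also have "?c X * ?c M = ?c (X * M)" by (rule of_real_hom.mat_hom_mult[OF X M, symmetric])
    also have "\<dots> = 0\<^sub>m k n" unfolding XM by (intro eq_matI) auto
    finally have "\<mu> \<cdot>\<^sub>v (?c X *\<^sub>v v) = 0\<^sub>v k" using v by auto
    hence Xv0: "?c X *\<^sub>v v = 0\<^sub>v k"
      using False Xv by (auto simp: vec_eq_iff)
    have zero: "A *\<^sub>v 0\<^sub>v k = 0\<^sub>v n" if "A \<in> carrier_mat n k" for A :: "complex mat"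
      using that by (intro eq_vecI) auto
    have NYX: "?c N * ?c Y * ?c X \<in> carrier_mat n n"
      by (rule mult_carrier_mat[OF mult_carrier_mat[OF carr(1,3)] carr(2)])
    have "?c M = ?c N - ?c N * ?c Y * ?c X"
    proof -
      have "?c M = ?c N - ?c (N * Y * X)"
        using N X Y unfolding M_def by (intro eq_matI) auto
      also have "?c (N * Y * X) = ?c N * ?c Y * ?c X"
        unfolding of_real_hom.mat_hom_mult[OF mult_carrier_mat[OF N Y] X]
          of_real_hom.mat_hom_mult[OF N Y] ..
      finally show ?thesis .
    qed
    hence "?c M *\<^sub>v v = ?c N *\<^sub>v v - (?c N * ?c Y) *\<^sub>v (?c X *\<^sub>v v)"
      using minus_mult_distrib_mat_vec[OF carr(1) NYX v(1)]
        assoc_mult_mat_vec[OF mult_carrier_mat[OF carr(1,3)] carr(2) v(1)] by simp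
    also have "\<dots> = ?c N *\<^sub>v v" unfolding Xv0 zero[OF mult_carrier_mat[OF carr(1,3)]] using carr v by auto
    finally have "eigenvalue (?c N) \<mu>"
      using v carr unfolding eigenvalue_def eigenvector_def by auto
    then show ?thesis using column_dominant_eigenvalue[OF N] dom by auto
  qed simp
  hence "0 \<le> Re (\<Sum>i<n. map_mat complex_of_real M $$ (i, i))"
    using M by (intro Re_trace_nonneg) auto
  hence "0 \<le> (\<Sum>i<n. M $$ (i, i))" using M by simp
  also have "\<dots> = (\<Sum>i<n. N $$ (i, i)) - (\<Sum>i<n. ((N * Y) * X) $$ (i, i))"
    using N X Y by (simp add: M_def sum_subtractf)
  also have "(\<Sum>i<n. ((N * Y) * X) $$ (i, i)) = (\<Sum>l<k. (X * (N * Y)) $$ (l, l))"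
    by (rule trace_mult_commute) (use N X Y in auto)
  also have "X * (N * Y) = (X * N) * Y" using X N Y
    by (simp add: assoc_mult_mat[of X k n N n Y k])
  also have "\<dots> = T" unfolding XN using XY X Y T
    by (simp add: assoc_mult_mat[of T k k X n Y k])
  finally show ?thesis by simp
qed

text \<open>\<open>trace_left_invariant_le\<close> for arbitrary finite index sets, with the
  independent left eigenvectors as rows of \<open>X\<close> and \<open>T\<close> the diagonal matrix
  of their eigenvalues.\<close>

lemma sum_left_eigenvalues_le_trace:
  fixes N :: "'i \<Rightarrow> 'i \<Rightarrow> real" and x :: "'l \<Rightarrow> 'i \<Rightarrow> real" and t :: "'l \<Rightarrow> real"
  assumes fin: "finite I" "finite L"
    and dom: "\<And>j. j \<in> I \<Longrightarrow> (\<Sum>i\<in>I - {j}. \<bar>N i j\<bar>) \<le> N j j"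
    and eig: "\<And>l j. l \<in> L \<Longrightarrow> j \<in> I \<Longrightarrow> (\<Sum>i\<in>I. x l i * N i j) = t l * x l j"
    and indep: "\<And>c. (\<And>i. i \<in> I \<Longrightarrow> (\<Sum>l\<in>L. c l * x l i) = 0) \<Longrightarrow> \<forall>l\<in>L. c l = 0"
  shows "(\<Sum>l\<in>L. t l) \<le> (\<Sum>i\<in>I. N i i)"
proof -
  obtain f where f: "bij_betw f {..<card I} I"
    using ex_bij_betw_nat_finite[OF fin(1)] by (auto simp: lessThan_atLeast0)
  obtain g where g: "bij_betw g {..<card L} L"
    using ex_bij_betw_nat_finite[OF fin(2)] by (auto simp: lessThan_atLeast0)
  have fI: "f i \<in> I" if "i < card I" for i using f that by (auto simp: bij_betw_def)
  have gL: "g l \<in> L" if "l < card L" for l using g that by (auto simp: bij_betw_def)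
  let ?N = "mat (card I) (card I) (\<lambda>(i, j). N (f i) (f j))"
  let ?X = "mat (card L) (card I) (\<lambda>(l, i). x (g l) (f i))"
  let ?T = "mat (card L) (card L) (\<lambda>(l, l'). if l = l' then t (g l) else 0)"
  have "(\<Sum>l<card L. ?T $$ (l, l)) \<le> (\<Sum>i<card I. ?N $$ (i, i))"
  proof (rule trace_left_invariant_le[where X = ?X])
    fix j assume j: "j < card I"
    have "bij_betw f ({..<card I} - {j}) (I - {f j})"
      using f j by (auto simp: bij_betw_def inj_on_def)
    hence "(\<Sum>i\<in>{..<card I} - {j}. \<bar>N (f i) (f j)\<bar>) = (\<Sum>i\<in>I - {f j}. \<bar>N i (f j)\<bar>)"
      by (rule sum.reindex_bij_betw)
    thus "(\<Sum>i\<in>{..<card I} - {j}. \<bar>?N $$ (i, j)\<bar>) \<le> ?N $$ (j, j)"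
      using dom[OF fI[OF j]] j by simp
  next
    show "?X * ?N = ?T * ?X"
    proof (rule eq_matI)
      fix l j assume "l < dim_row (?T * ?X)" "j < dim_col (?T * ?X)"
      hence lj: "l < card L" "j < card I" by auto
      have "(?X * ?N) $$ (l, j) = (\<Sum>i<card I. x (g l) (f i) * N (f i) (f j))"
        using lj by (simp add: scalar_prod_def lessThan_atLeast0)
      also have "\<dots> = (\<Sum>i\<in>I. x (g l) i * N i (f j))" by (rule sum.reindex_bij_betw[OF f])
      also have "\<dots> = t (g l) * x (g l) (f j)" using eig gL fI lj by simp
      also have "\<dots> = (\<Sum>l'<card L. if l' = l then t (g l) * x (g l) (f j) else 0)"
        using lj by simp
      also have "\<dots> = (\<Sum>l'<card L. (if l = l' then t (g l) else 0) * x (g l') (f j))"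
        by (intro sum.cong) auto
      also have "\<dots> = (?T * ?X) $$ (l, j)"
        using lj by (simp add: scalar_prod_def lessThan_atLeast0)
      finally show "(?X * ?N) $$ (l, j) = (?T * ?X) $$ (l, j)" .
    qed auto
  next
    fix v :: "real vec" assume v: "v \<in> carrier_vec (card L)"
      and zero: "transpose_mat ?X *\<^sub>v v = 0\<^sub>v (card I)"
    define c where "c l = v $ (the_inv_into {..<card L} g l)" for l
    have c: "c (g l) = v $ l" if "l < card L" for l
      using that g by (simp add: c_def the_inv_into_f_f bij_betw_def)
    have "\<forall>l\<in>L. c l = 0"
    proof (rule indep)
      fix i assume "i \<in> I"
      then obtain i' where i': "i' < card I" "i = f i'" using f by (auto simp: bij_betw_def)
      have "(\<Sum>l\<in>L. c l * x l i) = (\<Sum>l<card L. c (g l) * x (g l) i)"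
        by (rule sum.reindex_bij_betw[OF g, symmetric])
      also have "\<dots> = (transpose_mat ?X *\<^sub>v v) $ i'"
        using i' v by (simp add: scalar_prod_def lessThan_atLeast0 c mult.commute)
      finally show "(\<Sum>l\<in>L. c l * x l i) = 0" using zero i' by simp
    qed
    thus "v = 0\<^sub>v (card L)" using v c gL by (intro eq_vecI) (metis carrier_vecD index_zero_vec, auto)
  qed auto
  moreover have "(\<Sum>i<card I. ?N $$ (i, i)) = (\<Sum>i\<in>I. N i i)"
    using sum.reindex_bij_betw[OF f, of "\<lambda>i. N i i"] by simp
  moreover have "(\<Sum>l<card L. ?T $$ (l, l)) = (\<Sum>l\<in>L. t l)"
    using sum.reindex_bij_betw[OF g, of t] by simp
  ultimately show ?thesis by simp
qed

section \<open>The Riccati equation\<close>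

text \<open>
  \<open>h\<close> is the minimal nonnegative solution of
  \<open>h\<^sub>i\<^sub>j (n - 1 + a\<^sub>i) = [i \<noteq> j] + (\<Sum>l. h\<^sub>i\<^sub>l a\<^sub>l h\<^sub>l\<^sub>j)\<close>, the limit of the increasing iterates \<open>H k\<close>.
  The deficits \<open>w k j\<close> of their column sums satisfy the recursion of the errors \<open>e k j\<close> with
  \<open>n - 1\<close> in place of the larger \<open>\<mu> - 1\<close>, and so dominate them.
\<close>

lemma riccati_solution:
  fixes a :: "'i \<Rightarrow> real" and I :: "'i set"
  assumes fin: "finite I" and card: "2 \<le> card I" and a: "\<And>i. i \<in> I \<Longrightarrow> 0 \<le> a i"
  shows "\<exists>h :: 'i \<Rightarrow> 'i \<Rightarrow> real. (\<forall>i\<in>I. \<forall>j\<in>I. 0 \<le> h i j) \<and> (\<forall>j\<in>I. (\<Sum>i\<in>I. h i j) \<le> 1) \<and>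
    (\<forall>(\<mu>::real) (x::'i \<Rightarrow> real) y. \<mu> > card I \<longrightarrow> (\<forall>j\<in>I. (\<mu> - 1) * y j = sum x I - x j) \<longrightarrow>
      (\<forall>j\<in>I. (\<mu> - card I) * x j = a j * (x j - y j)) \<longrightarrow>
      (\<forall>j\<in>I. (\<Sum>i\<in>I. x i * h i j) = y j))"
proof -
  define n where "n = real (card I)"
  have n: "n \<ge> 2" using card by (simp add: n_def)
  \<comment> \<open>The Riccati equation solved for its linear term; \<open>n \<ge> 2\<close> keeps
    the divisor positive even where \<open>a i = 0\<close>.\<close>
  define step where "step g i j =
    ((if i = j then 0 else 1) + (\<Sum>l\<in>I. a l * g i l * g l j)) / (n - 1 + a i)"
    for g :: "'i \<Rightarrow> 'i \<Rightarrow> real" and i j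
  define H where "H k = (step ^^ k) (\<lambda>_ _. 0)" for k
  have H0: "H 0 i j = 0" for i j by (simp add: H_def)
  have HS: "H (Suc k) = step (H k)" for k by (simp add: H_def)
  have pos: "n - 1 + a i > 0" if "i \<in> I" for i using a[OF that] n by linarith
  have rec: "(n - 1 + a i) * H (Suc k) i j
      = (if i = j then 0 else 1) + (\<Sum>l\<in>I. a l * H k i l * H k l j)" if "i \<in> I" for k i j
    using pos[OF that] unfolding HS step_def by simp
  have nn_mono: "\<forall>i\<in>I. \<forall>j\<in>I. 0 \<le> H k i j \<and> H k i j \<le> H (Suc k) i j" for k
  proof (induction k)
    case 0
    show ?case using pos by (simp add: HS H0 step_def less_imp_le)
  next
    case (Suc k)
    show ?case
    proof (intro ballI)
      fix i j assume ij: "i \<in> I" "j \<in> I"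
      have "(\<Sum>l\<in>I. a l * H k i l * H k l j) \<le> (\<Sum>l\<in>I. a l * H (Suc k) i l * H (Suc k) l j)"
        using Suc ij a by (intro sum_mono mult_mono mult_nonneg_nonneg) (auto intro: order_trans)
      hence "H (Suc k) i j \<le> H (Suc (Suc k)) i j"
        unfolding HS[of "Suc k"] HS[of k] step_def[of _ i j]
        using pos[OF ij(1)] by (intro divide_right_mono) (auto simp: HS)
      thus "0 \<le> H (Suc k) i j \<and> H (Suc k) i j \<le> H (Suc (Suc k)) i j"
        using Suc ij by (meson order_trans)
    qed
  qed
  hence nn: "0 \<le> H k i j" and mono: "H k i j \<le> H (Suc k) i j" if "i \<in> I" "j \<in> I" for k i j
    using that by auto
  define w where "w k j = 1 - (\<Sum>i\<in>I. H k i j)" for k j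
  have offdiag: "(\<Sum>i\<in>I. x i * (if i = j then 0 else 1)) = sum x I - x j"
    if "j \<in> I" for j and x :: "'i \<Rightarrow> real"
  proof -
    have "(\<Sum>i\<in>I. x i * (if i = j then 0 else 1)) = (\<Sum>i\<in>I. x i - (if i = j then x i else 0))"
      by (intro sum.cong) auto
    also have "\<dots> = sum x I - x j" using fin that by (simp add: sum_subtractf)
    finally show ?thesis .
  qed
  \<comment> \<open>The recursion multiplied from the left by a row vector. The all-ones vector will
    give the recursion of the deficits, and the given \<open>x\<close> that of the errors.\<close>
  have rec_left: "(\<Sum>i\<in>I. x i * ((n - 1 + a i) * H (Suc k) i j))
      = sum x I - x j + (\<Sum>l\<in>I. (\<Sum>i\<in>I. x i * H k i l) * a l * H k l j)"
    if "j \<in> I" for x k j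
  proof -
    have "(\<Sum>i\<in>I. x i * ((n - 1 + a i) * H (Suc k) i j)) =
        (\<Sum>i\<in>I. x i * (if i = j then 0 else 1) + (\<Sum>l\<in>I. x i * H k i l * a l * H k l j))"
      using rec by (intro sum.cong) (auto simp: distrib_left sum_distrib_left mult_ac)
    also have "\<dots> = sum x I - x j + (\<Sum>i\<in>I. \<Sum>l\<in>I. x i * H k i l * a l * H k l j)"
      using that by (simp only: sum.distrib offdiag)
    also have "(\<Sum>i\<in>I. \<Sum>l\<in>I. x i * H k i l * a l * H k l j)
        = (\<Sum>l\<in>I. (\<Sum>i\<in>I. x i * H k i l) * a l * H k l j)"
      by (subst sum.swap) (simp add: sum_distrib_right)
    finally show ?thesis .
  qed
  \<comment> \<open>Every term on the right is nonnegative, the second sum by monotonicity of the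
    iterates, so no column sum ever exceeds 1.\<close>
  have w_rec: "(n - 1) * w (Suc k) j
      = (\<Sum>l\<in>I. w k l * a l * H k l j) + (\<Sum>i\<in>I. a i * (H (Suc k) i j - H k i j))"
    if "j \<in> I" for k j
  proof -
    have "(\<Sum>i\<in>I. (n - 1 + a i) * H (Suc k) i j)
        = n - 1 + (\<Sum>l\<in>I. (\<Sum>i\<in>I. H k i l) * a l * H k l j)"
      using rec_left[OF that, of "\<lambda>_. 1" k] by (simp add: n_def)
    moreover have "(\<Sum>l\<in>I. w k l * a l * H k l j)
        = (\<Sum>l\<in>I. a l * H k l j) - (\<Sum>l\<in>I. (\<Sum>i\<in>I. H k i l) * a l * H k l j)"
      by (simp add: w_def left_diff_distrib sum_subtractf)
    moreover have "(\<Sum>i\<in>I. (n - 1 + a i) * H (Suc k) i j)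
        = (n - 1) * (\<Sum>i\<in>I. H (Suc k) i j) + (\<Sum>i\<in>I. a i * H (Suc k) i j)"
      by (simp add: distrib_right sum.distrib sum_distrib_left)
    ultimately show ?thesis
      by (simp add: w_def right_diff_distrib sum_subtractf)
  qed
  have w_nn: "\<forall>j\<in>I. 0 \<le> w k j" for k
  proof (induction k)
    case 0
    show ?case by (simp add: w_def H0)
  next
    case (Suc k)
    have "0 \<le> (n - 1) * w (Suc k) j" if "j \<in> I" for j
      unfolding w_rec[OF that] using Suc a nn mono that
      by (intro add_nonneg_nonneg sum_nonneg mult_nonneg_nonneg) auto
    thus ?case using n by (auto simp: zero_le_mult_iff)
  qed
  have bounded: "H k i j \<le> 1" if "i \<in> I" "j \<in> I" for k i j
  proof -
    have "H k i j \<le> (\<Sum>i\<in>I. H k i j)"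
      using fin that nn by (intro member_le_sum) auto
    also have "\<dots> \<le> 1" using w_nn[of k] that by (simp add: w_def)
    finally show ?thesis .
  qed
  define h where "h i j = lim (\<lambda>k. H k i j)" for i j
  have lim: "(\<lambda>k. H k i j) \<longlonglongrightarrow> h i j" if "i \<in> I" "j \<in> I" for i j
    unfolding h_def convergent_LIMSEQ_iff[symmetric]
    using mono[OF that] bounded[OF that] nn[OF that]
    by (intro Bseq_mono_convergent BseqI'[of _ 1]) (auto intro: incseq_SucI simp: incseq_def[symmetric] mono_def[symmetric])
  \<comment> \<open>The limiting deficits. In the limit the increments
    \<open>H (Suc k) - H k\<close> drop out, which leaves a homogeneous equation for
    \<open>v\<close>.\<close>
  define v where "v j = 1 - (\<Sum>i\<in>I. h i j)" for j
  have limw: "(\<lambda>k. w k j) \<longlonglongrightarrow> v j" if "j \<in> I" for j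
    unfolding w_def v_def using lim that by (intro tendsto_intros) auto
  have v_rec: "(n - 1) * v j = (\<Sum>l\<in>I. v l * a l * h l j)" if j: "j \<in> I" for j
  proof (rule LIMSEQ_unique)
    show "(\<lambda>k. (n - 1) * w (Suc k) j) \<longlonglongrightarrow> (n - 1) * v j"
      using limw[OF j] by (intro tendsto_intros LIMSEQ_Suc)
    have "(\<lambda>k. (\<Sum>l\<in>I. w k l * a l * H k l j) + (\<Sum>i\<in>I. a i * (H (Suc k) i j - H k i j)))
        \<longlonglongrightarrow> (\<Sum>l\<in>I. v l * a l * h l j) + (\<Sum>i\<in>I. a i * (h i j - h i j))"
      using j by (intro tendsto_intros limw lim LIMSEQ_Suc) auto
    thus "(\<lambda>k. (n - 1) * w (Suc k) j) \<longlonglongrightarrow> (\<Sum>l\<in>I. v l * a l * h l j)"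
      using w_rec[OF j] by simp
  qed
  have v_nn: "0 \<le> v j" if "j \<in> I" for j
    using limw[OF that] w_nn that by (intro LIMSEQ_le_const) auto
  have h_nn: "0 \<le> h i j" if "i \<in> I" "j \<in> I" for i j
    using lim[OF that] nn[OF that] by (intro LIMSEQ_le_const) auto
  show ?thesis
  proof (intro exI[of _ h] conjI ballI allI impI)
    show "0 \<le> h i j" if "i \<in> I" "j \<in> I" for i j by (rule h_nn[OF that])
    show "(\<Sum>i\<in>I. h i j) \<le> 1" if "j \<in> I" for j using v_nn[OF that] by (simp add: v_def)
  next
    fix \<mu> :: real and x y j
    assume gt: "\<mu> > card I" and y: "\<forall>j\<in>I. (\<mu> - 1) * y j = sum x I - x j"
      and x: "\<forall>j\<in>I. (\<mu> - card I) * x j = a j * (x j - y j)" and "j \<in> I"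
    have gt': "\<mu> > n" using gt by (simp add: n_def)
    have l1: "\<mu> - 1 > 0" using gt' n by simp
    \<comment> \<open>\<open>e k\<close> measures how far \<open>x * H k\<close> is from
      \<open>y\<close>, and \<open>d\<close> is its limit; the aim is \<open>d = 0\<close>.\<close>
    define e where "e k j = (\<Sum>i\<in>I. x i * H k i j) - y j" for k j
    define d where "d j = (\<Sum>i\<in>I. x i * h i j) - y j" for j
    have e_rec: "(\<mu> - 1) * e (Suc k) j
        = (\<Sum>l\<in>I. e k l * a l * H k l j) - (\<Sum>i\<in>I. y i * a i * (H (Suc k) i j - H k i j))"
      if j: "j \<in> I" for k j
    proof -
      \<comment> \<open>The second equation between \<open>x\<close> and \<open>y\<close> trades the
        varying weight \<open>n - 1 + a i\<close> for the constant \<open>\<mu> - 1\<close>, at the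
        price of a term in \<open>y\<close>.\<close>
      have "(\<Sum>i\<in>I. x i * ((n - 1 + a i) * H (Suc k) i j))
          = (\<Sum>i\<in>I. ((\<mu> - 1) * x i + y i * a i) * H (Suc k) i j)"
      proof (rule sum.cong)
        fix i assume "i \<in> I"
        from x[rule_format, OF this] have "x i * (n - 1 + a i) = (\<mu> - 1) * x i + y i * a i"
          by (simp add: n_def algebra_simps)
        thus "x i * ((n - 1 + a i) * H (Suc k) i j) = ((\<mu> - 1) * x i + y i * a i) * H (Suc k) i j"
          by (metis mult.assoc)
      qed simp
      also have "\<dots> = (\<mu> - 1) * (\<Sum>i\<in>I. x i * H (Suc k) i j) + (\<Sum>i\<in>I. y i * a i * H (Suc k) i j)"
        by (simp add: distrib_right sum.distrib sum_distrib_left mult.assoc)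
      finally have 1: "\<dots> = (\<mu> - 1) * y j + (\<Sum>l\<in>I. (\<Sum>i\<in>I. x i * H k i l) * a l * H k l j)"
        using rec_left[OF j, of x k] y j by simp
      have 2: "(\<Sum>l\<in>I. e k l * a l * H k l j)
          = (\<Sum>l\<in>I. (\<Sum>i\<in>I. x i * H k i l) * a l * H k l j) - (\<Sum>i\<in>I. y i * a i * H k i j)"
        by (simp add: e_def left_diff_distrib sum_subtractf)
      show ?thesis unfolding 2 e_def[of "Suc k"]
        using 1 by (simp add: right_diff_distrib sum_subtractf)
    qed
    \<comment> \<open>As \<open>H 0\<close> vanishes, \<open>e 0\<close> is \<open>- y\<close> while
      \<open>w 0\<close> is constantly 1, so a common bound of the \<open>\<bar>y i\<bar>\<close>
      starts the induction.\<close>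
    define C where "C = (\<Sum>i\<in>I. \<bar>y i\<bar>)"
    have C: "\<bar>y i\<bar> \<le> C" if "i \<in> I" for i
      unfolding C_def using fin that by (intro member_le_sum) auto
    have e_bound: "\<forall>j\<in>I. \<bar>e k j\<bar> \<le> C * w k j" for k
    proof (induction k)
      case 0
      show ?case using C by (simp add: e_def w_def H0)
    next
      case (Suc k)
      show ?case
      proof
        fix j assume j: "j \<in> I"
        have "(\<mu> - 1) * \<bar>e (Suc k) j\<bar> = \<bar>(\<mu> - 1) * e (Suc k) j\<bar>"
          using l1 by (simp add: abs_mult)
        also have "\<dots> \<le> (\<Sum>l\<in>I. \<bar>e k l * a l * H k l j\<bar>)
            + (\<Sum>i\<in>I. \<bar>y i * a i * (H (Suc k) i j - H k i j)\<bar>)"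
          unfolding e_rec[OF j] by (rule order_trans[OF abs_triangle_ineq4]) (intro add_mono sum_abs)
        also have "\<dots> \<le> (\<Sum>l\<in>I. C * (w k l * a l * H k l j))
            + (\<Sum>i\<in>I. C * (a i * (H (Suc k) i j - H k i j)))"
        proof (intro add_mono sum_mono)
          fix l assume l: "l \<in> I"
          have "\<bar>e k l\<bar> * (a l * H k l j) \<le> C * w k l * (a l * H k l j)"
            using Suc l j a nn by (intro mult_right_mono) auto
          thus "\<bar>e k l * a l * H k l j\<bar> \<le> C * (w k l * a l * H k l j)"
            using a[OF l] nn[OF l j] by (simp add: abs_mult mult_ac)
          have "\<bar>y l\<bar> * (a l * (H (Suc k) l j - H k l j)) \<le> C * (a l * (H (Suc k) l j - H k l j))"
            using C[OF l] a[OF l] mono[OF l j] by (intro mult_right_mono) auto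
          thus "\<bar>y l * a l * (H (Suc k) l j - H k l j)\<bar> \<le> C * (a l * (H (Suc k) l j - H k l j))"
            using a[OF l] mono[OF l j] by (simp add: abs_mult mult_ac)
        qed
        also have "\<dots> = C * ((n - 1) * w (Suc k) j)"
          unfolding w_rec[OF j] by (simp add: distrib_left sum_distrib_left)
        \<comment> \<open>Here \<open>\<mu> > n\<close> enters: the deficits are nonnegative, so
          their factor may grow to the one in the recursion of the errors.\<close>
        also have "\<dots> \<le> C * ((\<mu> - 1) * w (Suc k) j)"
          using C[OF j] gt' w_nn[of "Suc k"] j
          by (intro mult_left_mono mult_right_mono) auto
        finally have "(\<mu> - 1) * \<bar>e (Suc k) j\<bar> \<le> (\<mu> - 1) * (C * w (Suc k) j)"
          by (simp add: mult_ac)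
        thus "\<bar>e (Suc k) j\<bar> \<le> C * w (Suc k) j" using l1 by simp
      qed
    qed
    have lime: "(\<lambda>k. e k j) \<longlonglongrightarrow> d j" if "j \<in> I" for j
      unfolding e_def d_def using lim that by (intro tendsto_intros) auto
    have d_rec: "(\<mu> - 1) * d j = (\<Sum>l\<in>I. d l * a l * h l j)" if j: "j \<in> I" for j
    proof (rule LIMSEQ_unique)
      show "(\<lambda>k. (\<mu> - 1) * e (Suc k) j) \<longlonglongrightarrow> (\<mu> - 1) * d j"
        using lime[OF j] by (intro tendsto_intros LIMSEQ_Suc)
      have "(\<lambda>k. (\<Sum>l\<in>I. e k l * a l * H k l j) - (\<Sum>i\<in>I. y i * a i * (H (Suc k) i j - H k i j)))
          \<longlonglongrightarrow> (\<Sum>l\<in>I. d l * a l * h l j) - (\<Sum>i\<in>I. y i * a i * (h i j - h i j))"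
        using j by (intro tendsto_intros lime lim LIMSEQ_Suc) auto
      thus "(\<lambda>k. (\<mu> - 1) * e (Suc k) j) \<longlonglongrightarrow> (\<Sum>l\<in>I. d l * a l * h l j)"
        using e_rec[OF j] by simp
    qed
    \<comment> \<open>Domination only gives \<open>\<bar>d j\<bar> \<le> C * v j\<close>. But
      multiplying \<open>d\<close> by \<open>A h\<close> from the right scales it by
      \<open>\<mu> - 1\<close>, and \<open>v\<close> only by \<open>n - 1\<close>. As
      \<open>A h\<close> is nonnegative, each pass of the bound through it gains a factor
      \<open>q < 1\<close>, which forces \<open>d = 0\<close>.\<close>
    define q where "q = (n - 1) / (\<mu> - 1)"
    have q: "0 \<le> q" "q < 1" using n gt' by (auto simp: q_def)
    have d_bound: "\<forall>j\<in>I. \<bar>d j\<bar> \<le> C * q ^ k * v j" for k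
    proof (induction k)
      case 0
      show ?case
      proof
        fix j assume j: "j \<in> I"
        have "(\<lambda>k. \<bar>e k j\<bar>) \<longlonglongrightarrow> \<bar>d j\<bar>" "(\<lambda>k. C * w k j) \<longlonglongrightarrow> C * v j"
          using lime[OF j] limw[OF j] by (auto intro!: tendsto_intros)
        thus "\<bar>d j\<bar> \<le> C * q ^ 0 * v j"
          using e_bound j by (auto intro: LIMSEQ_le)
      qed
    next
      case (Suc k)
      show ?case
      proof
        fix j assume j: "j \<in> I"
        have "(\<mu> - 1) * \<bar>d j\<bar> = \<bar>\<Sum>l\<in>I. d l * a l * h l j\<bar>"
          unfolding d_rec[OF j, symmetric] using l1 by (simp add: abs_mult)
        also have "\<dots> \<le> (\<Sum>l\<in>I. \<bar>d l * a l * h l j\<bar>)" by (rule sum_abs)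
        also have "\<dots> \<le> (\<Sum>l\<in>I. C * q ^ k * (v l * a l * h l j))"
        proof (rule sum_mono)
          fix l assume l: "l \<in> I"
          have "\<bar>d l\<bar> * (a l * h l j) \<le> C * q ^ k * v l * (a l * h l j)"
            using Suc l j a h_nn by (intro mult_right_mono) auto
          thus "\<bar>d l * a l * h l j\<bar> \<le> C * q ^ k * (v l * a l * h l j)"
            using a[OF l] h_nn[OF l j] by (simp add: abs_mult mult_ac)
        qed
        also have "\<dots> = C * q ^ k * ((n - 1) * v j)"
          unfolding v_rec[OF j] by (simp add: sum_distrib_left)
        also have "n - 1 = (\<mu> - 1) * q" using l1 by (simp add: q_def)
        finally have "(\<mu> - 1) * \<bar>d j\<bar> \<le> (\<mu> - 1) * (C * q ^ Suc k * v j)"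
          by (simp add: mult_ac)
        thus "\<bar>d j\<bar> \<le> C * q ^ Suc k * v j" using l1 by simp
      qed
    qed
    have "(\<lambda>k. C * q ^ k * v j) \<longlonglongrightarrow> C * 0 * v j"
      using q by (intro tendsto_intros LIMSEQ_realpow_zero)
    hence "\<bar>d j\<bar> \<le> 0" using d_bound \<open>j \<in> I\<close> by (intro LIMSEQ_le_const) auto
    thus "(\<Sum>i\<in>I. x i * h i j) = y j" by (simp add: d_def)
  qed
qed

section \<open>Cliques with pendant vertices\<close>

text \<open>Cauchy-Schwarz against the constant 1, from expanding the squares of all differences
  \<open>f i - f j\<close>.\<close>

lemma square_sum_le:
  fixes f :: "'i \<Rightarrow> real"
  shows "sum f A * sum f A \<le> card A * (\<Sum>i\<in>A. f i * f i)"
proof -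
  have "0 \<le> (\<Sum>i\<in>A. \<Sum>j\<in>A. (f i - f j) * (f i - f j))" by (intro sum_nonneg) auto
  also have "\<dots> = (\<Sum>i\<in>A. \<Sum>j\<in>A. f i * f i + f j * f j - 2 * (f i * f j))"
    by (intro sum.cong) (auto simp: algebra_simps)
  also have "\<dots> = 2 * (card A * (\<Sum>i\<in>A. f i * f i)) - 2 * (sum f A * sum f A)"
    by (simp add: sum.distrib sum_subtractf sum_product flip: sum_distrib_left)
  finally show ?thesis by simp
qed

text \<open>A homogeneous system with more unknowns than equations. Gaussian elimination:
  \<open>l0\<close> is the pivot of equation \<open>i\<close>, \<open>g\<close> has that equation
  cleared, and \<open>k'\<close> solves it for the unknown \<open>l0\<close>.\<close>

lemma exists_nontrivial_kernel:
  fixes f :: "'l \<Rightarrow> 'i \<Rightarrow> real"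
  assumes "finite C" "finite L" "card C < card L"
  shows "\<exists>k. (\<exists>l\<in>L. k l \<noteq> 0) \<and> (\<forall>i\<in>C. (\<Sum>l\<in>L. k l * f l i) = 0)"
  using assms
proof (induction C arbitrary: L f rule: finite_induct)
  case empty
  then have "L \<noteq> {}" by auto
  then show ?case by (intro exI[of _ "\<lambda>_. 1"]) auto
next
  case (insert i C)
  show ?case
  proof (cases "\<forall>l\<in>L. f l i = 0")
    case True
    with insert.IH[of L f] insert.prems insert.hyps show ?thesis by auto
  next
    case False
    then obtain l0 where l0: "l0 \<in> L" "f l0 i \<noteq> 0" by auto
    define g where "g l j = f l j - f l i / f l0 i * f l0 j" for l j
    have "card C < card (L - {l0})" using insert l0 by simp
    from insert.IH[OF _ this, of g] insert.prems obtain k where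
      k: "\<exists>l\<in>L - {l0}. k l \<noteq> 0" "\<forall>j\<in>C. (\<Sum>l\<in>L - {l0}. k l * g l j) = 0" by auto
    define s where "s = (\<Sum>l\<in>L - {l0}. k l * f l i)"
    define k' where "k' = k(l0 := - s / f l0 i)"
    have sum_k': "(\<Sum>l\<in>L. k' l * f l j) = - s / f l0 i * f l0 j + (\<Sum>l\<in>L - {l0}. k l * f l j)" for j
      using l0 insert.prems by (subst sum.remove[of _ l0]) (auto simp: k'_def intro!: sum.cong)
    have "(\<Sum>l\<in>L - {l0}. k l * g l j) = (\<Sum>l\<in>L. k' l * f l j)" for j
    proof -
      have "(\<Sum>l\<in>L - {l0}. k l * g l j)
          = (\<Sum>l\<in>L - {l0}. k l * f l j - k l * f l i * (f l0 j / f l0 i))"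
        by (simp add: g_def algebra_simps)
      also have "\<dots> = (\<Sum>l\<in>L - {l0}. k l * f l j) - s * (f l0 j / f l0 i)"
        by (simp only: s_def sum_subtractf sum_distrib_right)
      finally show ?thesis unfolding sum_k' by (simp add: algebra_simps)
    qed
    moreover have "(\<Sum>l\<in>L. k' l * f l i) = 0"
      unfolding sum_k' using l0 by (simp add: s_def)
    moreover have "\<exists>l\<in>L. k' l \<noteq> 0" using k(1) by (auto simp: k'_def)
    ultimately show ?thesis using k(2) by auto
  qed
qed

text \<open>Each \<open>y\<close> in \<open>Vb\<close> hangs on the clique vertex
  \<open>c y\<close>. The spectral estimates are made for functions on the vertices, free of matrix
  indices.\<close>

locale pendant_clique =
  fixes Vg Vb :: "'a set" and c :: "'a \<Rightarrow> 'a"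
  assumes finite_Vg: "finite Vg" and finite_Vb: "finite Vb"
    and disjoint: "Vg \<inter> Vb = {}" and attach: "c ` Vb \<subseteq> Vg"
begin

definition pend :: "'a \<Rightarrow> nat" where
  "pend i = card {y \<in> Vb. c y = i}"

text \<open>The Laplacian as an operator. The degree of a clique vertex is
  \<open>card Vg - 1 + pend v\<close>; as \<open>sum z Vg\<close> includes \<open>z v\<close>
  itself, the coefficient is larger by one.\<close>

definition lap :: "('a \<Rightarrow> real) \<Rightarrow> 'a \<Rightarrow> real" where
  "lap z v = (if v \<in> Vg
     then (real (card Vg) + real (pend v)) * z v - sum z Vg - (\<Sum>y\<in>{y \<in> Vb. c y = v}. z y)
     else z v - z (c v))"

lemma lap_Vb: "y \<in> Vb \<Longrightarrow> lap z y = z y - z (c y)"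
  using disjoint by (auto simp: lap_def)

lemma attach_in: "y \<in> Vb \<Longrightarrow> c y \<in> Vg"
  using attach by auto

lemma sum_pend_mult: "(\<Sum>i\<in>Vg. real (pend i) * f i) = (\<Sum>y\<in>Vb. f (c y))"
proof -
  have "(\<Sum>i\<in>Vg. real (pend i) * f i) = (\<Sum>i\<in>Vg. \<Sum>y\<in>{y \<in> Vb. c y = i}. f (c y))"
    by (intro sum.cong) (auto simp: pend_def)
  also have "\<dots> = (\<Sum>y\<in>Vb. f (c y))"
    using finite_Vg finite_Vb attach by (intro sum.group) auto
  finally show ?thesis .
qed

lemma sum_pend: "sum pend Vg = card Vb"
proof -
  have "real (sum pend Vg) = real (card Vb)" using sum_pend_mult[of "\<lambda>_. 1"] by simp
  thus ?thesis by linarith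
qed

lemma pend_pos: "y \<in> Vb \<Longrightarrow> 0 < pend (c y)"
  using finite_Vb by (auto simp: pend_def card_gt_0_iff)

lemma sum_split: "(\<Sum>v\<in>Vg \<union> Vb. f v) = sum f Vg + sum f Vb"
  using finite_Vg finite_Vb disjoint by (rule sum.union_disjoint)

text \<open>The Dirichlet form, with the clique edges summed in closed form and one product of
  differences per pendant edge. With \<open>u\<close> constant it shows that \<open>lap z\<close>
  has sum zero; with \<open>u = z\<close> it is nonnegative by Cauchy-Schwarz.\<close>

lemma lap_inner:
  fixes u z :: "'a \<Rightarrow> real"
  shows "(\<Sum>v\<in>Vg \<union> Vb. u v * lap z v) = card Vg * (\<Sum>v\<in>Vg. u v * z v) - sum u Vg * sum z Vg
     + (\<Sum>y\<in>Vb. (u y - u (c y)) * (z y - z (c y)))"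
proof -
  have "(\<Sum>v\<in>Vg. u v * lap z v) = (\<Sum>v\<in>Vg. card Vg * (u v * z v) + real (pend v) * (u v * z v)
      - u v * sum z Vg - (\<Sum>y\<in>{y \<in> Vb. c y = v}. u (c y) * z y))"
    by (intro sum.cong) (auto simp: lap_def algebra_simps sum_distrib_left)
  also have "\<dots> = card Vg * (\<Sum>v\<in>Vg. u v * z v) + (\<Sum>y\<in>Vb. u (c y) * z (c y))
      - sum u Vg * sum z Vg - (\<Sum>v\<in>Vg. \<Sum>y\<in>{y \<in> Vb. c y = v}. u (c y) * z y)"
    by (simp add: sum.distrib sum_subtractf sum_pend_mult flip: sum_distrib_left sum_distrib_right)
  also have "(\<Sum>v\<in>Vg. \<Sum>y\<in>{y \<in> Vb. c y = v}. u (c y) * z y) = (\<Sum>y\<in>Vb. u (c y) * z y)"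
    using finite_Vg finite_Vb attach by (intro sum.group) auto
  finally show ?thesis
    by (simp add: sum_split lap_Vb algebra_simps sum.distrib sum_subtractf)
qed

lemma sum_lap: "(\<Sum>v\<in>Vg \<union> Vb. lap z v) = 0"
  using lap_inner[of "\<lambda>_. 1" z] by simp

lemma lap_form_nonneg: "0 \<le> (\<Sum>v\<in>Vg \<union> Vb. z v * lap z v)"
proof -
  have "0 \<le> (\<Sum>y\<in>Vb. (z y - z (c y)) * (z y - z (c y)))" by (intro sum_nonneg) auto
  thus ?thesis unfolding lap_inner using square_sum_le[of z Vg] by simp
qed

lemma lap_sum: "lap (\<lambda>v. \<Sum>l\<in>L. k l * z l v) v = (\<Sum>l\<in>L. k l * lap (z l) v)"
proof (cases "v \<in> Vg")
  case True
  then show ?thesis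
    by (simp add: lap_def right_diff_distrib sum_subtractf sum_distrib_left mult_ac
        sum.swap[of _ L Vg] sum.swap[of _ L "{y \<in> Vb. c y = v}"])
next
  case False
  then show ?thesis by (simp add: lap_def right_diff_distrib sum_subtractf)
qed

lemma eigenvalue_nonneg:
  assumes "\<And>v. v \<in> Vg \<union> Vb \<Longrightarrow> lap z v = \<mu> * z v" and "(\<Sum>v\<in>Vg \<union> Vb. z v * z v) = 1"
  shows "0 \<le> \<mu>"
proof -
  have "(\<Sum>v\<in>Vg \<union> Vb. z v * lap z v) = (\<Sum>v\<in>Vg \<union> Vb. \<mu> * (z v * z v))"
    using assms(1) by (intro sum.cong) auto
  thus ?thesis using assms(2) lap_form_nonneg[of z] by (simp flip: sum_distrib_left)
qed

text \<open>Otherwise some nonzero combination \<open>Z\<close> of the eigenvectors vanishes at all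
  clique vertices that carry pendants, and its form is below its squared norm. But then the pendant
  edges contribute exactly the squares on \<open>Vb\<close>. Since \<open>i\<close> carries a
  pendant, \<open>Z\<close> has at most \<open>card Vg - 1\<close> support points in the clique, so
  by Cauchy-Schwarz the clique contributes at least the squares there.\<close>

lemma card_eigenvalues_less_one:
  fixes z :: "'l \<Rightarrow> 'a \<Rightarrow> real" and \<mu> :: "'l \<Rightarrow> real"
  assumes L: "finite L"
    and orth: "\<And>l k. l \<in> L \<Longrightarrow> k \<in> L \<Longrightarrow> (\<Sum>v\<in>Vg \<union> Vb. z l v * z k v) = (if l = k then 1 else 0)"
    and eig: "\<And>l v. l \<in> L \<Longrightarrow> v \<in> Vg \<union> Vb \<Longrightarrow> lap (z l) v = \<mu> l * z l v"
    and less: "\<And>l. l \<in> L \<Longrightarrow> \<mu> l < 1"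
    and pos: "i \<in> Vg" "0 < pend i"
  shows "card L \<le> card {i \<in> Vg. 0 < pend i}"
proof (rule ccontr)
  define C where "C = {i \<in> Vg. 0 < pend i}"
  have finC: "finite C" using finite_Vg by (simp add: C_def)
  assume "\<not> card L \<le> card {i \<in> Vg. 0 < pend i}"
  hence "card C < card L" by (simp add: C_def)
  from exists_nontrivial_kernel[OF finC L this, of z] obtain k where
    k: "\<exists>l\<in>L. k l \<noteq> 0" "\<forall>i\<in>C. (\<Sum>l\<in>L. k l * z l i) = 0" by auto
  define Z where "Z v = (\<Sum>l\<in>L. k l * z l v)" for v
  \<comment> \<open>The coefficients \<open>r\<close> are kept free: \<open>k l * \<mu> l\<close>
    gives the form of \<open>Z\<close>, and \<open>k\<close> its squared norm.\<close>
  have inner: "(\<Sum>v\<in>Vg \<union> Vb. Z v * (\<Sum>l\<in>L. r l * z l v)) = (\<Sum>l\<in>L. k l * r l)" for r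
  proof -
    have "(\<Sum>v\<in>Vg \<union> Vb. Z v * (\<Sum>l\<in>L. r l * z l v))
        = (\<Sum>v\<in>Vg \<union> Vb. \<Sum>l\<in>L. \<Sum>j\<in>L. k l * r j * (z l v * z j v))"
      by (simp add: Z_def sum_product mult_ac)
    also have "\<dots> = (\<Sum>l\<in>L. \<Sum>j\<in>L. k l * r j * (\<Sum>v\<in>Vg \<union> Vb. z l v * z j v))"
      by (simp add: sum.swap[of _ L "Vg \<union> Vb"] sum_distrib_left)
    also have "\<dots> = (\<Sum>l\<in>L. \<Sum>j\<in>L. if l = j then k l * r j else 0)"
      using orth by (intro sum.cong) auto
    finally show ?thesis using L by simp
  qed
  have "(\<Sum>v\<in>Vg \<union> Vb. Z v * lap Z v) = (\<Sum>v\<in>Vg \<union> Vb. Z v * (\<Sum>l\<in>L. k l * \<mu> l * z l v))"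
    unfolding Z_def lap_sum using eig by (intro sum.cong) (auto simp: mult.assoc)
  also have "\<dots> = (\<Sum>l\<in>L. k l * (k l * \<mu> l))" by (rule inner)
  also have "\<dots> < (\<Sum>l\<in>L. k l * k l)"
  proof (rule sum_strict_mono_ex1[OF L])
    show "\<forall>l\<in>L. k l * (k l * \<mu> l) \<le> k l * k l"
    proof
      fix l assume "l \<in> L"
      hence "(k l * k l) * \<mu> l \<le> (k l * k l) * 1"
        using less by (intro mult_left_mono) (auto intro: less_imp_le)
      thus "k l * (k l * \<mu> l) \<le> k l * k l" by (simp add: mult.assoc)
    qed
    obtain l where l: "l \<in> L" "k l \<noteq> 0" using k(1) by auto
    hence "(k l * k l) * \<mu> l < (k l * k l) * 1"
      using less by (intro mult_strict_left_mono) (auto simp: zero_less_mult_iff)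
    thus "\<exists>l\<in>L. k l * (k l * \<mu> l) < k l * k l" using l by (auto simp: mult.assoc)
  qed
  also have "\<dots> = (\<Sum>v\<in>Vg \<union> Vb. Z v * Z v)" using inner[of k] by (simp add: Z_def)
  finally have lt: "(\<Sum>v\<in>Vg \<union> Vb. Z v * lap Z v) < (\<Sum>v\<in>Vg. Z v * Z v) + (\<Sum>y\<in>Vb. Z y * Z y)"
    by (simp add: sum_split)
  have ZC: "Z v = 0" if "v \<in> C" for v using k(2) that by (simp add: Z_def)
  have "(\<Sum>y\<in>Vb. (Z y - Z (c y)) * (Z y - Z (c y))) = (\<Sum>y\<in>Vb. Z y * Z y)"
    using ZC attach_in pend_pos by (intro sum.cong) (auto simp: C_def)
  with lt have lt': "card Vg * (\<Sum>v\<in>Vg. Z v * Z v) - sum Z Vg * sum Z Vg < (\<Sum>v\<in>Vg. Z v * Z v)"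
    unfolding lap_inner by simp
  have "sum Z Vg = sum Z (Vg - C)" and sq: "(\<Sum>v\<in>Vg. Z v * Z v) = (\<Sum>v\<in>Vg - C. Z v * Z v)"
    using ZC finite_Vg by (auto intro!: sum.mono_neutral_right)
  hence "sum Z Vg * sum Z Vg \<le> card (Vg - C) * (\<Sum>v\<in>Vg. Z v * Z v)"
    using square_sum_le[of Z "Vg - C"] by simp
  also have "card (Vg - C) < card Vg"
    using pos finite_Vg by (intro psubset_card_mono) (auto simp: C_def)
  hence "card (Vg - C) * (\<Sum>v\<in>Vg. Z v * Z v) \<le> (real (card Vg) - 1) * (\<Sum>v\<in>Vg. Z v * Z v)"
    by (intro mult_right_mono sum_nonneg) auto
  finally show False using lt' by (simp add: algebra_simps)
qed

text \<open>
  Adding the constant \<open>sum z Vg / (\<mu> - card Vg)\<close> turns an eigenvector \<open>z\<close> of \<open>lap\<close> into one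
  of \<open>\<lambda>z v. lap z v + sum z Vg\<close>, with the same eigenvalue. The values of the new vector at the pendant
  vertices depend on those at the clique through the Riccati solution \<open>h\<close>, so that its restriction
  to the clique is a left eigenvector of \<open>(I - h) * diag pend\<close>.
\<close>

lemma sum_eigenvalues_greater_card:
  fixes z :: "'l \<Rightarrow> 'a \<Rightarrow> real" and \<mu> :: "'l \<Rightarrow> real"
  assumes L: "finite L" and card: "2 \<le> card Vg"
    and orth: "\<And>l k. l \<in> L \<Longrightarrow> k \<in> L \<Longrightarrow> (\<Sum>v\<in>Vg \<union> Vb. z l v * z k v) = (if l = k then 1 else 0)"
    and eig: "\<And>l v. l \<in> L \<Longrightarrow> v \<in> Vg \<union> Vb \<Longrightarrow> lap (z l) v = \<mu> l * z l v"
    and gt: "\<And>l. l \<in> L \<Longrightarrow> \<mu> l > card Vg"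
  shows "(\<Sum>l\<in>L. \<mu> l - card Vg) \<le> card Vb"
proof -
  obtain h :: "'a \<Rightarrow> 'a \<Rightarrow> real" where h_nn: "\<forall>i\<in>Vg. \<forall>j\<in>Vg. 0 \<le> h i j"
    and h_col: "\<forall>j\<in>Vg. (\<Sum>i\<in>Vg. h i j) \<le> 1"
    and h: "\<forall>(\<nu>::real) (x::'a \<Rightarrow> real) y. \<nu> > card Vg \<longrightarrow> (\<forall>j\<in>Vg. (\<nu> - 1) * y j = sum x Vg - x j) \<longrightarrow>
      (\<forall>j\<in>Vg. (\<nu> - card Vg) * x j = real (pend j) * (x j - y j)) \<longrightarrow>
      (\<forall>j\<in>Vg. (\<Sum>i\<in>Vg. x i * h i j) = y j)"
    using riccati_solution[OF finite_Vg card, of "\<lambda>i. real (pend i)", OF of_nat_0_le_iff] by blast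
  define N where "N i j = ((if i = j then 1 else 0) - h i j) * pend j" for i j
  define d where "d l = sum (z l) Vg / (\<mu> l - card Vg)" for l
  define x where "x l v = z l v + d l" for l v
  \<comment> \<open>By \<open>y_eq\<close> and \<open>z_Vb\<close> this is the value of the shifted
    vector \<open>x l\<close> at every pendant vertex attached to \<open>j\<close>; the formula also
    makes sense where \<open>j\<close> has none.\<close>
  define y where "y l j = (sum (x l) Vg - x l j) / (\<mu> l - 1)" for l j
  have gt1: "\<mu> l > 1" if "l \<in> L" for l using gt[OF that] card by simp
  have y_eq: "y l j = d l - z l j / (\<mu> l - 1)" if l: "l \<in> L" for l j
  proof -
    have "d l * (\<mu> l - card Vg) = sum (z l) Vg" using gt[OF l] by (simp add: d_def)
    hence "sum (x l) Vg - x l j = (\<mu> l - 1) * d l - z l j"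
      by (simp add: x_def sum.distrib algebra_simps)
    thus ?thesis using gt1[OF l] by (simp add: y_def diff_divide_distrib)
  qed
  have z_Vb: "z l v = - z l (c v) / (\<mu> l - 1)" if l: "l \<in> L" and v: "v \<in> Vb" for l v
  proof -
    have "z l v * (\<mu> l - 1) = - z l (c v)"
      using eig[OF l, of v] v by (simp add: lap_Vb algebra_simps)
    thus ?thesis using gt1[OF l] by (subst eq_divide_eq) simp
  qed
  have x_eq: "(\<mu> l - card Vg) * x l j = real (pend j) * (x l j - y l j)"
    if l: "l \<in> L" and j: "j \<in> Vg" for l j
  proof -
    have "(\<Sum>v\<in>{v \<in> Vb. c v = j}. z l v) = (\<Sum>v\<in>{v \<in> Vb. c v = j}. - z l j / (\<mu> l - 1))"
      using z_Vb[OF l] by (intro sum.cong) auto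
    also have "\<dots> = - (real (pend j) * (z l j / (\<mu> l - 1)))" by (simp add: pend_def)
    finally have "(card Vg + real (pend j)) * z l j - sum (z l) Vg + real (pend j) * (z l j / (\<mu> l - 1))
        = \<mu> l * z l j"
      using eig[OF l, of j] j by (simp add: lap_def)
    moreover have "(\<mu> l - card Vg) * x l j = (\<mu> l - card Vg) * z l j + sum (z l) Vg"
      using gt[OF l] by (simp add: x_def d_def distrib_left)
    ultimately show ?thesis by (simp add: y_eq[OF l] x_def algebra_simps)
  qed
  have hxy: "(\<Sum>i\<in>Vg. x l i * h i j) = y l j" if l: "l \<in> L" and j: "j \<in> Vg" for l j
  proof -
    have "\<forall>j\<in>Vg. (\<mu> l - 1) * y l j = sum (x l) Vg - x l j" using gt1[OF l] by (simp add: y_def)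
    thus ?thesis using h gt[OF l] x_eq[OF l] j by blast
  qed
  have "(\<Sum>l\<in>L. \<mu> l - card Vg) \<le> (\<Sum>i\<in>Vg. N i i)"
  proof (rule sum_left_eigenvalues_le_trace[OF finite_Vg L, where x = x and N = N])
    fix j assume j: "j \<in> Vg"
    have "(\<Sum>i\<in>Vg - {j}. \<bar>N i j\<bar>) = (\<Sum>i\<in>Vg - {j}. h i j) * pend j"
      unfolding sum_distrib_right using h_nn j by (intro sum.cong) (auto simp: N_def abs_mult)
    \<comment> \<open>Column sums of \<open>h\<close> at most 1 make \<open>I - h\<close> column
      dominant, and scaling a column by \<open>pend j\<close> preserves this.\<close>
    also have "(\<Sum>i\<in>Vg - {j}. h i j) \<le> 1 - h j j"
      using h_col j finite_Vg j by (simp add: sum_diff1)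
    finally show "(\<Sum>i\<in>Vg - {j}. \<bar>N i j\<bar>) \<le> N j j" by (simp add: N_def mult_right_mono)
  next
    fix l j assume l: "l \<in> L" and j: "j \<in> Vg"
    have "(\<Sum>i\<in>Vg. x l i * N i j)
        = (\<Sum>i\<in>Vg. (if i = j then x l j * pend j else 0) - x l i * h i j * pend j)"
      by (intro sum.cong) (auto simp: N_def algebra_simps)
    also have "\<dots> = x l j * pend j - (\<Sum>i\<in>Vg. x l i * h i j) * pend j"
      using finite_Vg j by (simp add: sum_subtractf sum_distrib_right)
    also have "\<dots> = real (pend j) * (x l j - y l j)"
      unfolding hxy[OF l j] by (simp add: algebra_simps)
    finally show "(\<Sum>i\<in>Vg. x l i * N i j) = (\<mu> l - card Vg) * x l j" using x_eq[OF l j] by simp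
  next
    \<comment> \<open>Independence: if the \<open>x l\<close> cancel on the clique, so do the
      \<open>y l\<close>, hence the combination of the \<open>z l\<close> is constant on all
      vertices. Eigenvectors with nonzero eigenvalue have sum zero, so they are orthogonal to
      constants, and orthonormality gives \<open>k = 0\<close>.\<close>
    fix k :: "'l \<Rightarrow> real" assume k: "\<And>i. i \<in> Vg \<Longrightarrow> (\<Sum>l\<in>L. k l * x l i) = 0"
    define D where "D = (\<Sum>l\<in>L. k l * d l)"
    have ky: "(\<Sum>l\<in>L. k l * y l j) = 0" if j: "j \<in> Vg" for j
    proof -
      have "(\<Sum>l\<in>L. k l * y l j) = (\<Sum>l\<in>L. \<Sum>i\<in>Vg. k l * x l i * h i j)"
        using hxy[OF _ j] by (intro sum.cong) (auto simp: sum_distrib_left mult.assoc simp flip: hxy[OF _ j])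
      also have "\<dots> = (\<Sum>i\<in>Vg. (\<Sum>l\<in>L. k l * x l i) * h i j)"
        by (subst sum.swap) (simp add: sum_distrib_right)
      finally show ?thesis using k by simp
    qed
    have Z: "(\<Sum>l\<in>L. k l * z l v) = - D" if v: "v \<in> Vg \<union> Vb" for v
    proof (cases "v \<in> Vg")
      case True
      then show ?thesis using k[of v] by (simp add: x_def D_def distrib_left sum.distrib)
    next
      case False
      hence vb: "v \<in> Vb" using v by simp
      have "(\<Sum>l\<in>L. k l * z l v) = (\<Sum>l\<in>L. k l * (y l (c v) - d l))"
        using z_Vb[OF _ vb] y_eq by (intro sum.cong) auto
      also have "\<dots> = - D"
        using ky[OF attach_in[OF vb]] by (simp add: D_def right_diff_distrib sum_subtractf)
      finally show ?thesis .
    qed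
    show "\<forall>l\<in>L. k l = 0"
    proof
      fix l assume l: "l \<in> L"
      have "\<mu> l * (\<Sum>v\<in>Vg \<union> Vb. z l v) = (\<Sum>v\<in>Vg \<union> Vb. lap (z l) v)"
        unfolding sum_distrib_left using eig[OF l] by (intro sum.cong) auto
      hence zero: "(\<Sum>v\<in>Vg \<union> Vb. z l v) = 0" using sum_lap gt1[OF l] by simp
      have "k l = (\<Sum>j\<in>L. if j = l then k j else 0)" using L l by simp
      also have "\<dots> = (\<Sum>j\<in>L. k j * (\<Sum>v\<in>Vg \<union> Vb. z j v * z l v))"
        using orth l by (intro sum.cong) auto
      also have "\<dots> = (\<Sum>v\<in>Vg \<union> Vb. (\<Sum>j\<in>L. k j * z j v) * z l v)"
        unfolding sum_distrib_left sum_distrib_right by (subst sum.swap) (simp add: mult.assoc)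
      also have "\<dots> = - D * (\<Sum>v\<in>Vg \<union> Vb. z l v)"
        unfolding sum_distrib_left using Z by (intro sum.cong) auto
      finally show "k l = 0" using zero by simp
    qed
  qed
  also have "\<dots> \<le> (\<Sum>i\<in>Vg. real (pend i))"
    using h_nn by (intro sum_mono) (auto simp: N_def algebra_simps)
  also have "\<dots> = card Vb" using sum_pend by (simp flip: of_nat_sum)
  finally show ?thesis .
qed

lemma sum_eigenvalues_le:
  fixes z :: "nat \<Rightarrow> 'a \<Rightarrow> real" and e :: "nat \<Rightarrow> real"
  defines "m \<equiv> card (Vg \<union> Vb)"
  assumes orth: "\<And>l k. l < m \<Longrightarrow> k < m \<Longrightarrow> (\<Sum>v\<in>Vg \<union> Vb. z l v * z k v) = (if l = k then 1 else 0)"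
    and eig: "\<And>l v. l < m \<Longrightarrow> v \<in> Vg \<union> Vb \<Longrightarrow> lap (z l) v = e l * z l v"
    and trace: "(\<Sum>l<m. e l) = (\<Sum>i\<in>Vg. real (card Vg - 1 + pend i)) + card Vb"
    and j: "1 \<le> j" "j \<le> m"
  shows "(\<Sum>l<j. e l) \<le> (\<Sum>i\<in>Vg. real (min (card Vg - 1 + pend i) j)) + card Vb"
proof -
  define n where "n = card Vg"
  have m: "m = n + card Vb"
    using finite_Vg finite_Vb disjoint by (simp add: m_def n_def card_Un_disjoint)
  have e_nn: "0 \<le> e l" if "l < m" for l
    using eigenvalue_nonneg[of "z l" "e l"] eig[OF that] orth[OF that that] by simp
  have trace_split: "(\<Sum>l<m. e l) = (\<Sum>l<j. e l) + (\<Sum>l=j..<m. e l)"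
    using sum.atLeastLessThan_concat[of 0 j m e] j by (simp add: lessThan_atLeast0)
  consider "j < n" | "\<forall>i\<in>Vg. n - 1 + pend i \<le> j" | i0 where "n \<le> j" "i0 \<in> Vg" "j < n - 1 + pend i0"
    by force
  then show ?thesis
  proof cases
    case 1
    define L where "L = {l. l < m \<and> e l > n}"
    \<comment> \<open>Each eigenvalue is at most \<open>n\<close> plus its excess over
      \<open>n\<close>. The excesses of the first \<open>j\<close> are then enlarged to those of all
      eigenvalues above \<open>n\<close>.\<close>
    have "(\<Sum>l<j. e l) \<le> (\<Sum>l<j. real n + (if e l > n then e l - n else 0))"
      by (intro sum_mono) auto
    also have "\<dots> = real (n * j) + (\<Sum>l<j. if e l > n then e l - n else 0)"
      by (simp add: sum.distrib)
    also have "(\<Sum>l<j. if e l > n then e l - n else 0) = (\<Sum>l\<in>{l. l < j \<and> e l > n}. e l - n)"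
      by (simp add: sum.If_cases Collect_conj_eq lessThan_def)
    also have "\<dots> \<le> (\<Sum>l\<in>L. e l - n)"
      using j by (intro sum_mono2) (auto simp: L_def)
    also have "\<dots> \<le> card Vb"
      unfolding n_def
      by (rule sum_eigenvalues_greater_card[where z = z])
        (use 1 j orth eig in \<open>auto simp: L_def n_def\<close>)
    also have "real (n * j) = (\<Sum>i\<in>Vg. real (min (card Vg - 1 + pend i) j))"
    proof -
      have "(\<Sum>i\<in>Vg. real (min (card Vg - 1 + pend i) j)) = (\<Sum>i\<in>Vg. real j)"
        using 1 by (intro sum.cong) (auto simp: n_def)
      thus ?thesis by (simp add: n_def)
    qed
    finally show ?thesis by simp
  next
    case 2
    have "0 \<le> (\<Sum>l=j..<m. e l)" using e_nn by (intro sum_nonneg) auto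
    moreover have "(\<Sum>i\<in>Vg. real (card Vg - 1 + pend i)) = (\<Sum>i\<in>Vg. real (min (card Vg - 1 + pend i) j))"
      using 2 by (intro sum.cong) (auto simp: n_def)
    ultimately show ?thesis using trace trace_split by simp
  next
    case 3
    define p where "p = card {i \<in> Vg. 0 < pend i}"
    define L where "L = {l. l < m \<and> e l < 1}"
    have pos: "0 < pend i0" using 3 by (cases "pend i0") auto
    have "card L \<le> p"
      unfolding p_def
      by (rule card_eigenvalues_less_one[where z = z and \<mu> = e and i = i0])
        (use 3 pos orth eig in \<open>auto simp: L_def\<close>)
    \<comment> \<open>The tail has \<open>m - j\<close> eigenvalues; each counts at least 1 unless
      it is below 1, and then at least 0.\<close>
    moreover have "real (m - j) - card L \<le> (\<Sum>l=j..<m. e l)"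
    proof -
      have "card {l \<in> {j..<m}. e l < 1} \<le> card L"
        by (rule card_mono) (auto simp: L_def)
      hence "real (m - j) - card L \<le> real (m - j) - card {l \<in> {j..<m}. e l < 1}" by simp
      also have "\<dots> = (\<Sum>l=j..<m. 1 - (if e l < 1 then 1 else 0))"
        by (subst sum_subtractf) (simp add: sum.If_cases Int_def)
      also have "\<dots> \<le> (\<Sum>l=j..<m. e l)" using e_nn by (intro sum_mono) auto
      finally show ?thesis .
    qed
    ultimately have 1: "(\<Sum>l<j. e l) \<le> (\<Sum>l<m. e l) - real (m - j) + p"
      using trace_split by simp
    have "n \<ge> 1" using 3 finite_Vg by (auto simp: n_def Suc_le_eq card_gt_0_iff)
    \<comment> \<open>A vertex with pendants contributes at least \<open>n\<close>, the vertex
      \<open>i0\<close> even \<open>j\<close>. As \<open>m = n + card Vb\<close>, the total matches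
      the trace bound in fact \<open>1\<close> exactly.\<close>
    have "(\<Sum>i\<in>Vg. n - 1 + (if 0 < pend i then 1 else 0) + (if i = i0 then j - n else 0))
        \<le> (\<Sum>i\<in>Vg. min (n - 1 + pend i) j)"
      using 3 pos \<open>n \<ge> 1\<close> by (intro sum_mono) auto
    also have "(\<Sum>i\<in>Vg. n - 1 + (if 0 < pend i then 1 else 0) + (if i = i0 then j - n else 0))
        = n * (n - 1) + p + (j - n)"
      using 3 finite_Vg by (simp add: sum.distrib sum.If_cases p_def n_def Int_def)
    finally have "real (n * (n - 1) + p + (j - n)) \<le> real (\<Sum>i\<in>Vg. min (n - 1 + pend i) j)"
      by (rule of_nat_mono)
    moreover have "(\<Sum>l<m. e l) = real (n * (n - 1)) + 2 * real (card Vb)"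
      unfolding trace using sum_pend by (simp add: sum.distrib n_def flip: of_nat_sum)
    ultimately show ?thesis
      using 1 3(1) j(2) by (simp add: n_def[symmetric] of_nat_diff m)
  qed
qed

end

section \<open>Laplacians\<close>

text \<open>The characteristic polynomial splits over the complex numbers with real roots, so the
  sorted list misses none of them. This lets the diagonalization list the eigenvalues in decreasing
  order.\<close>

lemma char_poly_eigenvalues_desc:
  assumes A: "A \<in> carrier_mat n n" and sym: "transpose_mat A = A"
  shows "char_poly A = (\<Prod>a\<leftarrow>eigenvalues_desc A. [:- a, 1:])"
proof -
  interpret real_poly: map_poly_inj_comm_ring_hom complex_of_real ..
  have C: "map_mat complex_of_real A \<in> carrier_mat n n" using A by simp
  from char_poly_factorized[OF C] obtain as
    where as: "char_poly (map_mat complex_of_real A) = (\<Prod>a\<leftarrow>as. [:- a, 1:])" by blast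
  have "a \<in> \<real>" if "a \<in> set as" for a
  proof (rule symmetric_real_eigenvalue[OF A sym])
    have "poly (char_poly (map_mat complex_of_real A)) a = 0"
      using that unfolding as by (auto simp: poly_prod_list prod_list_zero_iff)
    thus "eigenvalue (map_mat complex_of_real A) a"
      using eigenvalue_root_char_poly[OF C] by simp
  qed
  hence "\<exists>rs. as = map complex_of_real rs" by (auto simp: ex_map_conv elim: Reals_cases)
  then obtain rs where rs: "as = map complex_of_real rs" by blast
  have "map_poly complex_of_real (\<Prod>a\<leftarrow>xs. [:- a, 1:])
      = (\<Prod>a\<leftarrow>map complex_of_real xs. [:- a, 1:])" for xs
    by (induction xs)
      (simp_all add: real_poly.hom_mult of_real_hom.map_poly_pCons_hom del: mult_pCons_left)
  hence "map_poly complex_of_real (char_poly A) = map_poly complex_of_real (\<Prod>a\<leftarrow>rs. [:- a, 1:])"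
    using as unfolding rs of_real_hom.char_poly_hom[OF A] by simp
  hence cp: "char_poly A = (\<Prod>a\<leftarrow>rs. [:- a, 1:])" by simp
  have "proots (\<Prod>a\<leftarrow>rs. [:- a, 1:]) = mset rs"
  proof (induction rs)
    case (Cons r rs)
    have "(\<Prod>a\<leftarrow>rs. [:- a, 1:]) \<noteq> 0" by (auto simp: prod_list_zero_iff)
    thus ?case using Cons by (simp add: proots_mult del: mult_pCons_left)
  qed simp
  hence "mset (eigenvalues_desc A) = mset rs" by (simp add: eigenvalues_desc_def cp)
  hence "mset (map (\<lambda>a. [:- a, 1:]) (eigenvalues_desc A)) = mset (map (\<lambda>a. [:- a, 1:]) rs)"
    by simp
  thus ?thesis unfolding cp by (metis prod_mset_prod_list)
qed

text \<open>The columns of the orthogonal matrix \<open>P\<close>, read as functions on the vertices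
  through the position \<open>ix v\<close> of \<open>v\<close> in the list. The three claims are
  \<open>P\<^sup>T P = 1\<close>, \<open>A P = P D\<close> and the cyclicity of the trace.\<close>

lemma symmetric_kernel_eigenbasis:
  fixes K :: "'a \<Rightarrow> 'a \<Rightarrow> real" and vs :: "'a list"
  defines "m \<equiv> length vs"
  defines "A \<equiv> mat m m (\<lambda>(i, j). K (vs ! i) (vs ! j))"
  assumes vs: "distinct vs" and sym: "\<And>v w. v \<in> set vs \<Longrightarrow> w \<in> set vs \<Longrightarrow> K v w = K w v"
  shows "\<exists>z :: nat \<Rightarrow> 'a \<Rightarrow> real.
    (\<forall>l<m. \<forall>k<m. (\<Sum>v\<in>set vs. z l v * z k v) = (if l = k then 1 else 0)) \<and>
    (\<forall>l<m. \<forall>v\<in>set vs. (\<Sum>w\<in>set vs. K v w * z l w) = eigenvalues_desc A ! l * z l v) \<and>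
    (\<Sum>l<m. eigenvalues_desc A ! l) = (\<Sum>v\<in>set vs. K v v)"
proof -
  have A: "A \<in> carrier_mat m m" by (simp add: A_def)
  have symA: "transpose_mat A = A"
    using sym by (intro eq_matI) (auto simp: A_def m_def)
  obtain P where P: "P \<in> carrier_mat m m" "transpose_mat P * P = 1\<^sub>m m"
    and D: "transpose_mat P * A * P
      = mat m m (\<lambda>(i, j). if i = j then eigenvalues_desc A ! i else 0)" (is "_ = ?D")
    using real_symmetric_diagonalization[OF A symA char_poly_eigenvalues_desc[OF A symA]] by auto
  have PT: "transpose_mat P \<in> carrier_mat m m" using P by simp
  have PP: "P * transpose_mat P = 1\<^sub>m m" by (rule mat_mult_left_right_inverse[OF PT P])
  have AP: "A * P \<in> carrier_mat m m" using A P by simp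
  have "P * ?D = (P * transpose_mat P) * (A * P)"
    unfolding D[symmetric] assoc_mult_mat[OF PT A P(1)] assoc_mult_mat[OF P(1) PT AP] ..
  hence APD: "A * P = P * ?D" unfolding PP left_mult_one_mat[OF AP] ..
  define ix where "ix v = the_inv_into {..<m} ((!) vs) v" for v
  have bij: "bij_betw ((!) vs) {..<m} (set vs)"
    using bij_betw_nth[OF vs refl] by (simp add: m_def)
  have ix: "ix (vs ! i) = i" if "i < m" for i
    using that bij by (simp add: ix_def the_inv_into_f_f bij_betw_def)
  define z where "z l v = P $$ (ix v, l)" for l v
  have reindex: "(\<Sum>v\<in>set vs. f v) = (\<Sum>i<m. f (vs ! i))" for f :: "'a \<Rightarrow> real"
    by (rule sum.reindex_bij_betw[OF bij, symmetric])
  have "(\<Sum>v\<in>set vs. z l v * z k v) = (if l = k then 1 else 0)" if "l < m" "k < m" for l k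
  proof -
    have "(\<Sum>v\<in>set vs. z l v * z k v) = (transpose_mat P * P) $$ (l, k)"
      using that P(1) unfolding reindex by (simp add: z_def ix scalar_prod_def lessThan_atLeast0)
    thus ?thesis using that by (simp add: P(2))
  qed
  moreover have "(\<Sum>w\<in>set vs. K v w * z l w) = eigenvalues_desc A ! l * z l v"
    if l: "l < m" and v: "v \<in> set vs" for l v
  proof -
    obtain i where i: "i < m" "v = vs ! i" using v by (auto simp: in_set_conv_nth m_def)
    have "(\<Sum>w\<in>set vs. K v w * z l w) = (A * P) $$ (i, l)"
      using l i P(1) unfolding reindex
      by (simp add: z_def ix scalar_prod_def lessThan_atLeast0 A_def)
    also have "\<dots> = (\<Sum>k<m. P $$ (i, k) * (if k = l then eigenvalues_desc A ! k else 0))"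
      unfolding APD using l i P(1) by (simp add: scalar_prod_def lessThan_atLeast0)
    also have "\<dots> = (\<Sum>k<m. if k = l then P $$ (i, l) * eigenvalues_desc A ! l else 0)"
      by (intro sum.cong) auto
    finally show ?thesis using l i by (simp add: z_def ix)
  qed
  moreover have "(\<Sum>l<m. eigenvalues_desc A ! l) = (\<Sum>v\<in>set vs. K v v)"
  proof -
    have "(\<Sum>v\<in>set vs. K v v) = (\<Sum>i<m. (A * P * transpose_mat P) $$ (i, i))"
      unfolding reindex assoc_mult_mat[OF A P(1) PT] PP using A by (simp add: A_def)
    also have "\<dots> = (\<Sum>l<m. (transpose_mat P * (A * P)) $$ (l, l))"
      by (rule trace_mult_commute[OF AP PT])
    also have "transpose_mat P * (A * P) = ?D"
      using D unfolding assoc_mult_mat[OF PT A P(1)] .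
    finally show ?thesis by simp
  qed
  ultimately show ?thesis by blast
qed

lemma vertex_degree_eq_card: "vertex_degree G v = card {w. (v, w) \<in> parcs G}"
proof -
  have "out_arcs (with_proj G) v = Pair v ` {w. (v, w) \<in> parcs G}"
    by (auto simp: out_arcs_def)
  thus ?thesis by (simp add: vertex_degree_def out_degree_def card_image inj_on_def)
qed

text \<open>Double counting: a vertex of degree \<open>d\<close> is counted for exactly the levels
  \<open>l\<close> from 1 to \<open>min d j\<close>.\<close>

lemma sum_transpose_degree:
  assumes "finite (pverts G)"
  shows "(\<Sum>l = 1..j. transpose_degree G l) = (\<Sum>v\<in>pverts G. min (vertex_degree G v) j)"
proof -
  have "(\<Sum>l = 1..j. transpose_degree G l)
      = (\<Sum>l = 1..j. \<Sum>v\<in>pverts G. if l \<le> vertex_degree G v then 1 else 0)"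
    using assms by (simp add: transpose_degree_def sum.If_cases Int_def)
  also have "\<dots> = (\<Sum>v\<in>pverts G. card ({1..j} \<inter> {l. l \<le> vertex_degree G v}))"
    by (subst sum.swap) (simp add: sum.If_cases)
  also have "\<dots> = (\<Sum>v\<in>pverts G. min (vertex_degree G v) j)"
  proof (intro sum.cong refl)
    fix v
    have "{1..j} \<inter> {l. l \<le> vertex_degree G v} = {1..min (vertex_degree G v) j}" by auto
    thus "card ({1..j} \<inter> {l. l \<le> vertex_degree G v}) = min (vertex_degree G v) j" by simp
  qed
  finally show ?thesis .
qed

theorem mainTheorem1:
  fixes G :: "'a pair_pre_digraph" and Vg Vb :: "'a set" and vs :: "'a list" and j :: nat
  assumes "pair_graph G"
    and "semi_bipartite_regular 1 G Vg Vb"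
    and "distinct vs" and "set vs = pverts G"
    and "1 \<le> j" and "j \<le> card (pverts G)"
  shows "(\<Sum>l = 1..j. eigenvalues_desc (laplacian G vs) ! (l - 1))
           \<le> real (\<Sum>l = 1..j. transpose_degree G l)"
proof -
  interpret pair_graph G by fact
  have V: "pverts G = Vg \<union> Vb" and disj: "Vg \<inter> Vb = {}"
    and clique: "\<And>v w. v \<in> Vg \<Longrightarrow> w \<in> Vg \<Longrightarrow> v \<noteq> w \<Longrightarrow> (v, w) \<in> parcs G"
    and indep: "\<And>v w. v \<in> Vb \<Longrightarrow> w \<in> Vb \<Longrightarrow> (v, w) \<notin> parcs G"
    and deg1: "\<And>v. v \<in> Vb \<Longrightarrow> card {w. (v, w) \<in> parcs G} = 1"
    using assms(2) unfolding semi_bipartite_regular_def semi_bipartite_def clique_def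
      isolated_set_def vertex_degree_eq_card by auto
  have sym: "(v, w) \<in> parcs G \<longleftrightarrow> (w, v) \<in> parcs G" for v w
    using arcs_symmetric by blast
  have fin: "finite Vg" "finite Vb" using finite_verts V by auto
  \<comment> \<open>The unique neighbour of a pendant vertex; it lies in \<open>Vg\<close> because
    \<open>Vb\<close> is isolated. Outside \<open>Vb\<close> the value is unspecified.\<close>
  define c where "c y = (THE w. (y, w) \<in> parcs G)" for y
  have c: "(y, w) \<in> parcs G \<longleftrightarrow> w = c y" if y: "y \<in> Vb" for y w
  proof -
    obtain u where "{w. (y, w) \<in> parcs G} = {u}"
      using deg1[OF y] by (auto simp: card_1_singleton_iff)
    hence "(y, w) \<in> parcs G \<longleftrightarrow> w = u" for w by auto
    thus ?thesis by (simp add: c_def)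
  qed
  have cVg: "c y \<in> Vg" if "y \<in> Vb" for y
  proof -
    have "(y, c y) \<in> parcs G" using c[OF that] by simp
    thus ?thesis using V indep[OF that] in_arcsD2 by blast
  qed
  interpret pendant_clique Vg Vb c
    unfolding pendant_clique_def using fin disj cVg by blast
  have irrefl: "(v, v) \<notin> parcs G" for v using no_loops[of "(v, v)"] by auto
  have deg_Vg: "vertex_degree G i = card Vg - 1 + pend i" if i: "i \<in> Vg" for i
  proof -
    have "(i, w) \<in> parcs G \<longleftrightarrow> w \<in> (Vg - {i}) \<union> {y \<in> Vb. c y = i}" for w
    proof (cases "w \<in> Vb")
      case True
      then show ?thesis using c[OF True, of i] sym[of i w] disj by auto
    next
      case False
      then show ?thesis
        using clique[OF i, of w] irrefl[of w] in_arcsD2[of i w] V by (cases "w = i") auto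
    qed
    hence "{w. (i, w) \<in> parcs G} = (Vg - {i}) \<union> {y \<in> Vb. c y = i}" by auto
    moreover have "(Vg - {i}) \<inter> {y \<in> Vb. c y = i} = {}" using disj by auto
    ultimately show ?thesis
      using fin i by (simp add: vertex_degree_eq_card card_Un_disjoint pend_def)
  qed
  have deg_Vb: "vertex_degree G y = 1" if "y \<in> Vb" for y
    using deg1[OF that] by (simp add: vertex_degree_eq_card)
  \<comment> \<open>The rows of the Laplacian matrix act as \<open>lap\<close>, which carries the
    estimates of the locale over to the graph.\<close>
  have entry: "(\<Sum>w\<in>pverts G. laplacian_entry G v w * z w) = lap z v" if v: "v \<in> pverts G" for z v
  proof (cases "v \<in> Vg")
    case True
    have "(\<Sum>w\<in>Vg. laplacian_entry G v w * z w)
        = (\<Sum>w\<in>Vg. (if w = v then (real (vertex_degree G v) + 1) * z v else 0) - z w)"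
      using True clique by (intro sum.cong) (auto simp: laplacian_entry_def algebra_simps)
    also have "\<dots> = (card Vg + real (pend v)) * z v - sum z Vg"
    proof -
      have "card Vg \<ge> 1" using fin True by (auto simp: Suc_le_eq card_gt_0_iff)
      hence "real (vertex_degree G v) + 1 = card Vg + real (pend v)" by (simp add: deg_Vg[OF True])
      thus ?thesis using fin True by (simp add: sum_subtractf)
    qed
    finally have 1: "(\<Sum>w\<in>Vg. laplacian_entry G v w * z w)
        = (card Vg + real (pend v)) * z v - sum z Vg" .
    have "(\<Sum>w\<in>Vb. laplacian_entry G v w * z w) = (\<Sum>w\<in>Vb. if c w = v then - z w else 0)"
      using True disj c sym by (intro sum.cong) (auto simp: laplacian_entry_def)
    also have "\<dots> = - (\<Sum>w\<in>{w \<in> Vb. c w = v}. z w)"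
      using fin by (simp add: sum.If_cases Int_def sum_negf)
    finally show ?thesis using True 1 by (simp add: V sum_split lap_def)
  next
    case False
    hence vb: "v \<in> Vb" using v V by simp
    have "(\<Sum>w\<in>Vg. laplacian_entry G v w * z w) = (\<Sum>w\<in>Vg. if w = c v then - z (c v) else 0)"
      using False c[OF vb] by (intro sum.cong) (auto simp: laplacian_entry_def)
    moreover have "(\<Sum>w\<in>Vb. laplacian_entry G v w * z w) = (\<Sum>w\<in>Vb. if w = v then z v else 0)"
      using vb indep deg_Vb by (intro sum.cong) (auto simp: laplacian_entry_def)
    ultimately show ?thesis
      using fin vb cVg[OF vb] by (simp add: V sum_split lap_Vb)
  qed
  have entry_sym: "laplacian_entry G v w = laplacian_entry G w v" for v w
    using sym[of v w] by (simp add: laplacian_entry_def)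
  have len: "length vs = card (Vg \<union> Vb)" using assms(3,4) V distinct_card by metis
  obtain z :: "nat \<Rightarrow> 'a \<Rightarrow> real" where
    orth: "\<forall>l<length vs. \<forall>k<length vs. (\<Sum>v\<in>set vs. z l v * z k v) = (if l = k then 1 else 0)"
    and eig: "\<forall>l<length vs. \<forall>v\<in>set vs. (\<Sum>w\<in>set vs. laplacian_entry G v w * z l w)
      = eigenvalues_desc (laplacian G vs) ! l * z l v"
    and trace: "(\<Sum>l<length vs. eigenvalues_desc (laplacian G vs) ! l)
      = (\<Sum>v\<in>set vs. laplacian_entry G v v)"
    using symmetric_kernel_eigenbasis[OF assms(3), of "laplacian_entry G", OF entry_sym]
    unfolding laplacian_def by blast
  have "(\<Sum>l = 1..j. eigenvalues_desc (laplacian G vs) ! (l - 1))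
      = (\<Sum>l<j. eigenvalues_desc (laplacian G vs) ! l)"
    by (rule sum.reindex_bij_witness[of _ Suc "\<lambda>l. l - 1"]) auto
  also have "\<dots> \<le> (\<Sum>i\<in>Vg. real (min (card Vg - 1 + pend i) j)) + card Vb"
  proof (rule sum_eigenvalues_le[where z = z])
    show "(\<Sum>l<card (Vg \<union> Vb). eigenvalues_desc (laplacian G vs) ! l)
        = (\<Sum>i\<in>Vg. real (card Vg - 1 + pend i)) + card Vb"
      using trace unfolding len assms(4) V
      by (simp add: sum_split laplacian_entry_def deg_Vg deg_Vb)
  qed (use orth eig entry assms(4-6) V len in auto)
  \<comment> \<open>A pendant vertex has degree 1 and contributes \<open>min 1 j\<close>, which is 1
    because \<open>1 \<le> j\<close>.\<close>
  also have "\<dots> = real (\<Sum>v\<in>pverts G. min (vertex_degree G v) j)"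
    using assms(5) unfolding V by (simp add: sum_split deg_Vg deg_Vb)
  also have "\<dots> = real (\<Sum>l = 1..j. transpose_degree G l)"
    using sum_transpose_degree[of G j] finite_verts by simp
  finally show ?thesis .
qed

end
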